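(* Let $n\ge3$ and $k\ge1$ be integers and $T^k=\{1,2,\dots,2k+2\}\setminus\{2k\}$. Then $\mathcal{P}_{T^k}=\mathrm{span}\{P_i^{(n)}: i\in\{0,1,\dots,2k-1,2k+1,2k+2\}\}$ is a PULB-space for dimension $n$.
   Context: $d\mu_n(t)=\gamma_n(1-t^2)^{(n-3)/2}dt$ is the probability measure on $[-1,1]$ with this density; $P_i^{(n)}$ is the Gegenbauer polynomial of degree $i$ (Jacobi with $\alpha=\beta=(n-3)/2$, normalized $P_i^{(n)}(1)=1$). For $T\subset\mathbb{N}$, $\mathcal{P}_T=\mathrm{span}\{P_i^{(n)}:i\in T\cup\{0\}\}$. A function $h:[-1,1]\to[0,+\infty]$, continuous on $[-1,1]$ and finite on $[-1,1)$, is absolutely monotone if $h^{(j)}(t)\ge0$ for all $j\ge0$, $t\in[-1,1)$. $\mathcal{L}(n,T,h)=\{f\in\mathcal{P}_T: f\le h\text{ on }[-1,1]\}$. $\mathcal{P}_T$ is a PULB-space for dimension $n$ if (i) there exist nodes $\{\alpha_i\}_{i=1}^\ell\subset[-1,1]$ and weights $\{\rho_i\}\subset(0,1)$ with $\int_{-1}^1f\,d\mu_n=\sum_i\rho_if(\alpha_i)$ for all $f\in\mathcal{P}_T$, and (ii) for every absolutely monotone $h$ there exists $f\in\mathcal{L}(n,T,h)$ with $f(\alpha_i)=h(\alpha_i)$ for all $i$. *)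

theory Defs
  imports "HOL-Analysis.Analysis" "HOL-Library.Extended_Real"
begin

text \<open>Normalized Gegenbauer polynomials P_i^(n) (P_i(1) = 1), via the standard
three-term recurrence (Jacobi alpha = beta = (n-3)/2, normalized at 1):
  (i + n - 2) P_{i+1}(t) = (2i + n - 2) t P_i(t) - i P_{i-1}(t).\<close>
fun gegenbauer :: "nat \<Rightarrow> nat \<Rightarrow> real \<Rightarrow> real" where
  "gegenbauer n 0 t = 1"
| "gegenbauer n (Suc 0) t = t"
| "gegenbauer n (Suc (Suc i)) t =
     ((2 * real (Suc i) + real n - 2) * t * gegenbauer n (Suc i) t
       - real (Suc i) * gegenbauer n i t) / (real (Suc i) + real n - 2)"

definition weight_n :: "nat \<Rightarrow> real \<Rightarrow> real" where
  "weight_n n t = sqrt (1 - t\<^sup>2) ^ (n - 3)"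

definition gamma_n :: "nat \<Rightarrow> real" where
  "gamma_n n = 1 / integral {-1..1} (weight_n n)"

definition mu_integral :: "nat \<Rightarrow> (real \<Rightarrow> real) \<Rightarrow> real" where
  "mu_integral n f = gamma_n n * integral {-1..1} (\<lambda>t. f t * weight_n n t)"

definition poly_space :: "nat \<Rightarrow> nat set \<Rightarrow> (real \<Rightarrow> real) set" where
  "poly_space n T = {f. \<exists>c :: nat \<Rightarrow> real. \<forall>t. f t = (\<Sum>i\<in>T \<union> {0}. c i * gegenbauer n i t)}"

definition abs_monotone :: "(real \<Rightarrow> ereal) \<Rightarrow> bool" where
  "abs_monotone h \<longleftrightarrow>
     (\<forall>t\<in>{-1..1}. 0 \<le> h t) \<and>
     continuous_on {-1..1} h \<and>
     (\<forall>t\<in>{-1..<1}. h t \<noteq> \<infinity>) \<and>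
     (\<exists>D :: nat \<Rightarrow> real \<Rightarrow> real.
        (\<forall>t\<in>{-1..<1}. D 0 t = real_of_ereal (h t)) \<and>
        (\<forall>j. \<forall>t\<in>{-1..<1}. (D j has_real_derivative D (Suc j) t) (at t within {-1..<1})) \<and>
        (\<forall>j. \<forall>t\<in>{-1..<1}. 0 \<le> D j t))"

definition lower_set :: "nat \<Rightarrow> nat set \<Rightarrow> (real \<Rightarrow> ereal) \<Rightarrow> (real \<Rightarrow> real) set" where
  "lower_set n T h = {f \<in> poly_space n T. \<forall>t\<in>{-1..1}. ereal (f t) \<le> h t}"

definition PULB_space :: "nat \<Rightarrow> nat set \<Rightarrow> bool" where
  "PULB_space n T \<longleftrightarrow>
     (\<exists>(l::nat) (\<alpha>::nat \<Rightarrow> real) (\<rho>::nat \<Rightarrow> real).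
        (\<forall>i<l. \<alpha> i \<in> {-1..1} \<and> 0 < \<rho> i \<and> \<rho> i < 1) \<and>
        (\<forall>f\<in>poly_space n T. mu_integral n f = (\<Sum>i<l. \<rho> i * f (\<alpha> i))) \<and>
        (\<forall>h. abs_monotone h \<longrightarrow>
            (\<exists>f\<in>lower_set n T h. \<forall>i<l. ereal (f (\<alpha> i)) = h (\<alpha> i))))"

definition T_k :: "nat \<Rightarrow> nat set" where
  "T_k k = {1..2*k+2} - {2*k}"

end

theory Submission
  imports Defs "HOL-Computational_Algebra.Polynomial"
begin

text \<open>
  Let \<open>p\<^sub>m\<close> be the monic Gegenbauer polynomials, \<open>p\<^sub>m\<^sub>+\<^sub>1 = t p\<^sub>m - \<beta>\<^sub>m p\<^sub>m\<^sub>-\<^sub>1\<close>. The nodes are the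
  \<open>k + 1\<close> zeros of \<open>q = p\<^sub>k\<^sub>+\<^sub>1 + c p\<^sub>k\<^sub>-\<^sub>1 = t p\<^sub>k - (\<beta>\<^sub>k - c) p\<^sub>k\<^sub>-\<^sub>1\<close> with \<open>0 < c < \<beta>\<^sub>k\<close>; they lie in \<open>(-1, 1)\<close>
  because they interlace with those of \<open>p\<^sub>k\<close>. The interpolatory rule \<open>Q\<close> is exact in degree at most
  \<open>2k - 1\<close>, and on \<open>p\<^sub>2\<^sub>k\<^sub>+\<^sub>1\<close> by parity; its weights are positive since
  \<open>Q(p\<^sub>k\<^sup>2) = (\<beta>\<^sub>k - c) \<parallel>p\<^sub>k\<^sub>-\<^sub>1\<parallel>\<^sup>2 > 0\<close>. Writing \<open>q\<^sup>2 = p\<^sub>2\<^sub>k\<^sub>+\<^sub>2 + (2c + d) p\<^sub>2\<^sub>k + \<dots>\<close>, exactness on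
  \<open>p\<^sub>2\<^sub>k\<^sub>+\<^sub>2\<close> amounts to \<open>c\<^sup>2 + d c = \<beta>\<^sub>k \<beta>\<^sub>k\<^sub>+\<^sub>1\<close>, which has a root in \<open>(0, \<beta>\<^sub>k)\<close> because \<open>\<beta>\<^sub>k\<^sub>+\<^sub>1 < \<beta>\<^sub>k + d\<close>.

  For an absolutely monotone \<open>h\<close> let \<open>H\<close> be its Hermite interpolant at the doubled nodes, so \<open>H \<le> h\<close>.
  Its coefficient of \<open>t\<^sup>2\<^sup>k\<close> is nonnegative, being a combination of divided differences of \<open>h\<close> with
  nonnegative factors (the nodes sum to 0, and the last one is taken to be nonnegative). Hence for a suitable \<open>\<lambda> \<ge> 0\<close> the polynomial
  \<open>H - \<lambda> q\<^sup>2 \<le> h\<close> has no \<open>p\<^sub>2\<^sub>k\<close>-component.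
\<close>

section \<open>Monic Gegenbauer polynomials\<close>

text \<open>The header's \<open>\<beta>\<^sub>j\<close>: the factor that remains when the normalized
  three-term recurrence is divided by leading coefficients.\<close>

definition gegen_rec :: "nat \<Rightarrow> nat \<Rightarrow> real" where
  "gegen_rec n j = real j * (real j + real n - 3) / ((2 * real j + real n - 2) * (2 * real j + real n - 4))"

fun gegen_monic :: "nat \<Rightarrow> nat \<Rightarrow> real poly" where
  "gegen_monic n 0 = 1"
| "gegen_monic n (Suc 0) = [:0, 1:]"
| "gegen_monic n (Suc (Suc m)) =
     [:0, 1:] * gegen_monic n (Suc m) - smult (gegen_rec n (Suc m)) (gegen_monic n m)"

text \<open>The leading coefficient of the Gegenbauer polynomial normalized at 1.\<close>

fun gegen_lead :: "nat \<Rightarrow> nat \<Rightarrow> real" where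
  "gegen_lead n 0 = 1"
| "gegen_lead n (Suc m) = gegen_lead n m * (2 * real m + real n - 2) / (real m + real n - 2)"

definition mu_poly :: "nat \<Rightarrow> real poly \<Rightarrow> real" where
  "mu_poly n f = mu_integral n (poly f)"

lemma degree_gegen_monic_le: "degree (gegen_monic n m) \<le> m"
proof (induction n m rule: gegen_monic.induct)
  case (3 n m)
  show ?case
    by (simp only: gegen_monic.simps)
      (intro degree_diff_le order.trans[OF degree_mult_le] order.trans[OF degree_smult_le];
       use 3 in simp)
qed simp_all

lemma coeff_gegen_monic_ge: "m < i \<Longrightarrow> coeff (gegen_monic n m) i = 0"
  using degree_gegen_monic_le[of n m] by (intro coeff_eq_0) linarith

lemma coeff_gegen_monic_lead [simp]: "coeff (gegen_monic n m) m = 1"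
  by (induction n m rule: gegen_monic.induct) (auto simp: coeff_pCons coeff_gegen_monic_ge)

lemma degree_gegen_monic [simp]: "degree (gegen_monic n m) = m"
  using degree_gegen_monic_le[of n m] le_degree[of "gegen_monic n m" m] by simp

lemma coeff_gegen_monic_second [simp]: "coeff (gegen_monic n (Suc m)) m = 0"
proof (induction m)
  case (Suc m)
  thus ?case by (cases m) (auto simp: coeff_pCons coeff_gegen_monic_ge)
qed simp

text \<open>By the recurrence this coefficient is minus the sum of \<open>gegen_rec n 1\<close> up
  to \<open>gegen_rec n (Suc m)\<close>. Its closed form is what makes \<open>quad_shift\<close>
  computable.\<close>

lemma coeff_gegen_monic_third:
  assumes "n \<ge> 3"
  shows "coeff (gegen_monic n (Suc (Suc m))) m = - (real m + 2) * (real m + 1) / (2 * (2 * real m + real n))"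
proof (induction m)
  case 0
  show ?case using assms by (simp add: gegen_rec_def field_simps)
next
  case (Suc m)
  have "coeff (gegen_monic n (Suc (Suc (Suc m)))) (Suc m)
      = coeff (gegen_monic n (Suc (Suc m))) m - gegen_rec n (Suc (Suc m))"
    by (simp del: gegen_monic.simps(3) add: gegen_monic.simps(3)[of n "Suc m"])
  also have "\<dots> = - (real (Suc m) + 2) * (real (Suc m) + 1) / (2 * (2 * real (Suc m) + real n))"
  proof -
    have nz: "2 * real m + real n \<noteq> 0" "2 * real m + real n + 2 \<noteq> 0"
      using assms by (auto simp: add_eq_0_iff)
    have r: "gegen_rec n (Suc (Suc m)) = (real m + 2) * (real m + real n - 1) / ((2 * real m + real n + 2) * (2 * real m + real n))"
      by (simp add: gegen_rec_def algebra_simps)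
    show ?thesis unfolding Suc.IH r using nz by (simp add: divide_simps) (simp add: algebra_simps)
  qed
  finally show ?case .
qed

lemma gegen_monic_minus: "poly (gegen_monic n m) (- t) = (- 1) ^ m * poly (gegen_monic n m) t"
  by (induction n m rule: gegen_monic.induct) (auto simp: algebra_simps)

lemma gegen_lead_pos: "n \<ge> 3 \<Longrightarrow> gegen_lead n m > 0"
  by (induction m) auto

lemma gegenbauer_eq_monic:
  assumes "n \<ge> 3"
  shows "gegenbauer n m t = gegen_lead n m * poly (gegen_monic n m) t"
  using assms
proof (induction n m t rule: gegenbauer.induct)
  case (3 n i t)
  have nz: "real i + real n - 2 \<noteq> 0" "real i + real n - 1 \<noteq> 0" "2 * real i + real n - 2 \<noteq> 0" "2 * real i + real n \<noteq> 0"
    using 3 by auto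
  \<comment> \<open>This matches the last term of the monic recurrence with the last term of the
    normalized one.\<close>
  have *: "gegen_lead n (Suc (Suc i)) * gegen_rec n (Suc i) = gegen_lead n i * (real i + 1) / (real i + real n - 1)"
    using nz by (simp add: gegen_rec_def divide_simps add_ac) (simp add: algebra_simps)
  have "gegen_lead n (Suc (Suc i)) * poly (gegen_monic n (Suc (Suc i))) t
    = gegen_lead n (Suc (Suc i)) * t * poly (gegen_monic n (Suc i)) t
      - (gegen_lead n (Suc (Suc i)) * gegen_rec n (Suc i)) * poly (gegen_monic n i) t"
    by (simp add: algebra_simps del: gegen_lead.simps)
  also have "\<dots> = (2 * real i + real n) / (real i + real n - 1) * t * (gegen_lead n (Suc i) * poly (gegen_monic n (Suc i)) t)
      - (real i + 1) / (real i + real n - 1) * (gegen_lead n i * poly (gegen_monic n i) t)"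
    unfolding * by (simp add: gegen_lead.simps(2)[of n "Suc i"] algebra_simps del: gegen_lead.simps)
  finally show ?case
    using 3 by (simp del: gegen_lead.simps gegen_monic.simps(3) add: diff_divide_distrib algebra_simps)
qed (auto simp: field_simps)

lemma gegenbauer_at_1:
  assumes "n \<ge> 3"
  shows "gegenbauer n m 1 = 1"
  using assms
proof (induction n m "1::real" rule: gegenbauer.induct)
  case (3 n i)
  hence "real (Suc i) + real n - 2 \<noteq> 0" by auto
  with 3 show ?case by (simp add: field_simps)
qed auto

lemma gegen_monic_at_1:
  assumes "n \<ge> 3"
  shows "poly (gegen_monic n m) 1 > 0"
  using gegenbauer_at_1[OF assms, of m] gegen_lead_pos[OF assms, of m]
  by (metis assms gegenbauer_eq_monic zero_less_mult_pos zero_less_one)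

lemma gegen_rec_pos:
  assumes "n \<ge> 3"
  shows "gegen_rec n (Suc m) > 0"
  using assms unfolding gegen_rec_def by (intro divide_pos_pos mult_pos_pos) auto

text \<open>The two relations need one joint induction: differentiating the recurrence produces the
  derivative of \<open>gegen_monic n m\<close>, which the second relation removes; the first then
  rewrites what remains. The factor \<open>\<delta>\<close> splits the recurrence coefficient:
  \<open>gegen_rec n (Suc m) = (1 - \<delta> (Suc m)) * \<delta> m\<close>.\<close>

lemma pderiv_gegen_monic_eval:
  assumes "n \<ge> 3"
  defines "\<delta> \<equiv> \<lambda>m. (real m + 1) / (2 * real m + real n - 2)"
  shows "(1 - t\<^sup>2) * poly (pderiv (gegen_monic n (Suc m))) t
           = - (real m + 1) * t * poly (gegen_monic n (Suc m)) t
             + (real m + real n - 2) * \<delta> m * poly (gegen_monic n m) t"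
    and "t * poly (pderiv (gegen_monic n (Suc m))) t - \<delta> m * poly (pderiv (gegen_monic n m)) t
           = (real m + 1) * poly (gegen_monic n (Suc m)) t"
proof (induction m)
  case 0
  case 1
  show ?case using assms by (simp add: \<delta>_def pderiv_pCons power2_eq_square pderiv_1 add_divide_distrib[symmetric] diff_divide_distrib[symmetric])
  case 2
  show ?case by (simp add: pderiv_pCons)
next
  case (Suc m)
  define P where "P = poly (gegen_monic n (Suc m)) t"
  define R where "R = poly (gegen_monic n m) t"
  define P' where "P' = poly (pderiv (gegen_monic n (Suc m))) t"
  define R' where "R' = poly (pderiv (gegen_monic n m)) t"
  define e where "e = (real m + real n - 2) / (2 * real m + real n)"
  have pos: "2 * real m + real n > 0" "2 * real m + real n - 2 > 0" using assms by auto
  have e: "1 - e = \<delta> (Suc m)" "\<delta> (Suc m) * (2 * real m + real n) = real m + 2"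
     "e * (2 * real m + real n) = real m + real n - 2" "gegen_rec n (Suc m) = e * \<delta> m"
    using pos by (auto simp: e_def \<delta>_def gegen_rec_def divide_simps)
  note IH = Suc[folded P_def R_def P'_def R'_def]
  have Q: "poly (gegen_monic n (Suc (Suc m))) t = t * P - e * \<delta> m * R"
    by (simp add: P_def R_def e)
  have Q': "poly (pderiv (gegen_monic n (Suc (Suc m)))) t = P + t * P' - e * (t * P' - (real m + 1) * P)"
    using IH(2) by (simp add: P_def R_def P'_def R'_def e pderiv_diff pderiv_mult pderiv_smult pderiv_pCons algebra_simps)
  have S: "real (Suc m) = real m + 1" by simp
  \<comment> \<open>Free reals stand for the polynomial values. Once \<open>N\<close>,
    \<open>x\<close> and \<open>e\<close> are expressed through \<open>d1\<close> and
    \<open>D\<close>, no fraction is left and both claims are ring identities.\<close>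
  have g1: "(1 - t\<^sup>2) * (P + t * P' - e * (t * P' - (x + 1) * P)) = - (x + 1 + 1) * t * (t * P - e * d * R) + (x + 1 + N - 2) * d1 * P" (is ?A)
   and g2: "t * (P + t * P' - e * (t * P' - (x + 1) * P)) - d1 * P' = (x + 1 + 1) * (t * P - e * d * R)" (is ?B)
    if e: "e + d1 = 1" and D1: "d1 * D = x + 2" and D2: "e * D = x + N - 2"
      and W: "(1 - t\<^sup>2) * P' = - (x + 1) * t * P + (x + N - 2) * d * R"
    for D x N e d1 d t P R P' :: real
  proof -
    have N: "x + N - 2 = e * D" "N = e * D - x + 2" and x: "x = d1 * D - 2" and e: "e = 1 - d1"
      using e D1 D2 by auto
    have "t * (P + t * P' - e * (t * P' - (x + 1) * P)) - d1 * P' = t * P * (1 + e * (x + 1)) - d1 * ((1 - t\<^sup>2) * P')"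
      unfolding e by (simp add: algebra_simps power2_eq_square)
    also have "\<dots> = (x + 1 + 1) * (t * P - e * d * R)"
      unfolding W N unfolding e x by (simp add: algebra_simps)
    finally show ?B .
    have "(1 - t\<^sup>2) * (P + t * P' - e * (t * P' - (x + 1) * P)) = (1 - t\<^sup>2) * P * (1 + e * (x + 1)) + t * d1 * ((1 - t\<^sup>2) * P')"
      unfolding e by (simp add: algebra_simps power2_eq_square)
    also have "\<dots> = - (x + 1 + 1) * t * (t * P - e * d * R) + (x + 1 + N - 2) * d1 * P"
      unfolding W N unfolding e x by (simp add: algebra_simps power2_eq_square)
    finally show ?A .
  qed
  have e1: "e + \<delta> (Suc m) = 1" using e(1) by simp
  case 1
  show ?case unfolding Q Q' S P_def[symmetric] by (rule g1[OF e1 e(2) e(3) IH(1)])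
  case 2
  show ?case unfolding Q Q' S P_def[symmetric] P'_def[symmetric] by (rule g2[OF e1 e(2) e(3) IH(1)])
qed

declare gegen_monic.simps(3) [simp del]

text \<open>Differentiate the first relation of \<open>pderiv_gegen_monic_eval\<close>; the second
  eliminates the derivative of the lower polynomial.\<close>

lemma gegen_monic_ode:
  assumes "n \<ge> 3"
  shows "[:1, 0, -1:] * pderiv (pderiv (gegen_monic n m))
           = smult (real n - 1) ([:0, 1:] * pderiv (gegen_monic n m)) - smult (real m * (real m + real n - 2)) (gegen_monic n m)"
proof (cases m)
  case 0
  thus ?thesis by (simp add: pderiv_1)
next
  case (Suc l)
  define p where "p = gegen_monic n (Suc l)"
  define r where "r = gegen_monic n l"
  define d where "d = (real l + 1) / (2 * real l + real n - 2)"
  have 1: "[:1, 0, -1:] * pderiv p = - smult (real l + 1) ([:0, 1:] * p) + smult ((real l + real n - 2) * d) r"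
    using pderiv_gegen_monic_eval(1)[OF assms, of _ l]
    by (intro poly_eq_poly_eq_iff[THEN iffD1] ext) (simp add: p_def r_def d_def algebra_simps power2_eq_square)
  have 2: "t * poly (pderiv p) t - d * poly (pderiv r) t = (real l + 1) * poly p t" for t
    using pderiv_gegen_monic_eval(2)[OF assms, of t l] by (simp add: p_def r_def d_def)
  have "poly (pderiv ([:1, 0, -1:] * pderiv p)) t
      = poly (pderiv (- smult (real l + 1) ([:0, 1:] * p) + smult ((real l + real n - 2) * d) r)) t" for t
    unfolding 1 ..
  hence 3: "(1 - t * t) * poly (pderiv (pderiv p)) t - 2 * t * poly (pderiv p) t
     = - (real l + 1) * (poly p t + t * poly (pderiv p) t) + (real l + real n - 2) * (d * poly (pderiv r) t)" for t
    by (simp add: pderiv_mult pderiv_add pderiv_minus pderiv_smult pderiv_pCons algebra_simps)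
  have 4: "d * poly (pderiv r) t = t * poly (pderiv p) t - (real l + 1) * poly p t" for t
    using 2[of t] by simp
  show ?thesis
    using 3[unfolded 4]
    by (intro poly_eq_poly_eq_iff[THEN iffD1] ext) (simp add: Suc p_def[symmetric] algebra_simps)
qed

section \<open>The weight, the integral functional and orthogonality\<close>

lemma continuous_on_weight: "continuous_on S (weight_n n)"
  unfolding weight_n_def by (intro continuous_intros)

lemma weight_poly_integrable: "(\<lambda>t. poly f t * weight_n n t) integrable_on {-1..1}"
  by (intro integrable_continuous_real continuous_intros continuous_on_weight)

lemma weight_nonneg: "t \<in> {-1..1} \<Longrightarrow> weight_n n t \<ge> 0"
  unfolding weight_n_def by (auto simp: abs_square_le_1 abs_le_iff)

lemma weight_pos: "t \<in> {-1<..<1} \<Longrightarrow> weight_n n t > 0"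
  unfolding weight_n_def by (auto simp: abs_square_less_1 abs_less_iff)

text \<open>A continuous nonnegative integrand with integral zero vanishes; as the weight is
  positive inside the interval, \<open>f\<close> would then have infinitely many zeros.\<close>

lemma weight_integral_sq_pos:
  assumes "f \<noteq> 0"
  shows "integral {-1..1} (\<lambda>t. poly (f * f) t * weight_n n t) > 0"
proof (rule ccontr)
  let ?g = "\<lambda>t. poly (f * f) t * weight_n n t"
  assume "\<not> ?thesis"
  moreover have nn: "?g t \<ge> 0" if "t \<in> {-1..1}" for t
    using that weight_nonneg[OF that, of n] by simp
  ultimately have "integral {-1..1} ?g = 0"
    using integral_nonneg[OF weight_poly_integrable[of "f * f"] nn] by linarith
  hence "\<forall>t\<in>{-1..1}. ?g t = 0"
    using nn by (subst (asm) integral_eq_0_iff) (auto intro!: continuous_intros continuous_on_weight)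
  hence "poly f t = 0" if "t \<in> {-1<..<1}" for t
    using that weight_pos[OF that, of n] by force
  hence "{-1<..<1} \<subseteq> {t. poly f t = 0}" by auto
  moreover have "infinite {-1<..<(1::real)}" by (simp add: infinite_Ioo)
  ultimately show False
    using poly_roots_finite[OF assms] finite_subset by blast
qed

lemma gamma_pos: "gamma_n n > 0"
  using weight_integral_sq_pos[of 1 n] by (simp add: gamma_n_def)

lemma mu_poly_eq: "mu_poly n f = gamma_n n * integral {-1..1} (\<lambda>t. poly f t * weight_n n t)"
  by (simp add: mu_poly_def mu_integral_def)

lemma mu_poly_add [simp]: "mu_poly n (f + g) = mu_poly n f + mu_poly n g"
  by (simp add: mu_poly_eq distrib_right integral_add weight_poly_integrable ring_distribs)

lemma mu_poly_smult [simp]: "mu_poly n (smult c f) = c * mu_poly n f"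
  by (simp add: mu_poly_eq mult.assoc)

lemma mu_poly_minus [simp]: "mu_poly n (- f) = - mu_poly n f"
  using mu_poly_smult[of n "- 1" f] by simp

lemma mu_poly_diff [simp]: "mu_poly n (f - g) = mu_poly n f - mu_poly n g"
  using mu_poly_add[of n f "- g"] by simp

lemma mu_poly_0 [simp]: "mu_poly n 0 = 0"
  by (simp add: mu_poly_eq)

lemma mu_poly_sum: "mu_poly n (sum f A) = (\<Sum>i\<in>A. mu_poly n (f i))"
  by (induction A rule: infinite_finite_induct) auto

lemma mu_poly_1 [simp]: "mu_poly n 1 = 1"
  using weight_integral_sq_pos[of 1 n] by (simp add: mu_poly_eq gamma_n_def)

lemma mu_poly_square_pos: "f \<noteq> 0 \<Longrightarrow> mu_poly n (f * f) > 0"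
  unfolding mu_poly_eq using gamma_pos weight_integral_sq_pos by simp

lemma mu_poly_square_nonneg: "mu_poly n (f * f) \<ge> 0"
  using mu_poly_square_pos[of f n] by (cases "f = 0") auto

text \<open>Up to the factor \<open>gamma_n n\<close>, the difference of the two sides is the
  integral of the derivative of \<open>sqrt (1 - t\<^sup>2) ^ (n - 1) * poly f t\<close>, a function
  that vanishes at both endpoints. Since the square root is not differentiable there, the
  fundamental theorem is used in the form that asks for derivatives in the interior only.\<close>

lemma mu_poly_divergence:
  assumes "n \<ge> 3"
  shows "mu_poly n ([:1, 0, -1:] * pderiv f) = (real n - 1) * mu_poly n ([:0, 1:] * f)"
proof -
  let ?F = "\<lambda>t. sqrt (1 - t\<^sup>2) ^ (n - 1) * poly f t"
  let ?G = "[:1, 0, -1:] * pderiv f - smult (real n - 1) ([:0, 1:] * f)"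
  have "((\<lambda>t. poly ?G t * weight_n n t) has_integral (?F 1 - ?F (-1))) {-1..1}"
  proof (rule fundamental_theorem_of_calculus_interior)
    fix t :: real assume t: "t \<in> {-1<..<1}"
    have pos: "1 - t\<^sup>2 > 0" using t by (simp add: abs_square_less_1 abs_less_iff)
    obtain m where m: "n = m + 3" using assms by (metis le_add_diff_inverse add.commute)
    define s where "s = sqrt (1 - t\<^sup>2)"
    have s: "s > 0" "s * s = 1 - t * t" using pos by (auto simp: s_def power2_eq_square)
    have "((\<lambda>t. sqrt (1 - t\<^sup>2)) has_real_derivative - t / s) (at t)"
      using pos unfolding s_def by (auto intro!: derivative_eq_intros simp: field_simps)
    from DERIV_mult[OF DERIV_power[OF this, of "n - 1"] poly_DERIV[of f]]
    have "(?F has_real_derivative real (n - 1) * (- t / s * s ^ (n - 2)) * poly f t + poly (pderiv f) t * s ^ (n - 1)) (at t)"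
      by (simp add: s_def m)
    also have "real (n - 1) * (- t / s * s ^ (n - 2)) * poly f t + poly (pderiv f) t * s ^ (n - 1)
       = poly ?G t * s ^ m"
    proof -
      have *: "- t / s * s ^ (n - 2) = - t * s ^ m" "s ^ (n - 1) = (1 - t * t) * s ^ m"
        using s by (simp_all add: m flip: s(2))
      show ?thesis unfolding * by (simp add: m algebra_simps)
    qed
    also have "\<dots> = poly ?G t * weight_n n t"
      by (simp add: weight_n_def s_def m)
    finally show "(?F has_vector_derivative poly ?G t * weight_n n t) (at t)"
      by (simp add: has_real_derivative_iff_has_vector_derivative)
  qed (auto intro!: continuous_intros)
  moreover have "?F 1 - ?F (-1) = 0" using assms by (simp add: power_0_left)
  ultimately have "integral {-1..1} (\<lambda>t. poly ?G t * weight_n n t) = 0"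
    by (metis integral_unique)
  hence "mu_poly n ?G = 0" by (simp only: mu_poly_eq mult_zero_right)
  thus ?thesis unfolding mu_poly_diff mu_poly_smult by linarith
qed

text \<open>The divergence identity for \<open>pderiv u * v\<close>. The right side is symmetric in
  \<open>u\<close> and \<open>v\<close>, so the Gegenbauer operator is self-adjoint.\<close>

lemma mu_poly_ode_symmetric:
  assumes "n \<ge> 3"
  shows "mu_poly n (([:1, 0, -1:] * pderiv (pderiv u) - smult (real n - 1) ([:0, 1:] * pderiv u)) * v)
       = - mu_poly n ([:1, 0, -1:] * (pderiv u * pderiv v))"
proof -
  define w :: "real poly" where "w = [:1, 0, -1:]"
  define x :: "real poly" where "x = [:0, 1:]"
  show ?thesis
    using mu_poly_divergence[OF assms, of "pderiv u * v"]
    unfolding w_def[symmetric] x_def[symmetric] by (simp add: pderiv_mult algebra_simps)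
qed

text \<open>Both polynomials are eigenvectors of a self-adjoint operator, and the eigenvalues differ
  by \<open>(i - j) * (i + j + n - 2)\<close> up to sign, which is nonzero.\<close>

lemma gegen_monic_orthogonal:
  assumes "n \<ge> 3" "i \<noteq> j"
  shows "mu_poly n (gegen_monic n i * gegen_monic n j) = 0"
proof -
  define ev where "ev = (\<lambda>m. real m * (real m + real n - 2))"
  have E: "[:1, 0, -1:] * pderiv (pderiv (gegen_monic n m)) - smult (real n - 1) ([:0, 1:] * pderiv (gegen_monic n m))
      = smult (- ev m) (gegen_monic n m)" for m
    unfolding gegen_monic_ode[OF assms(1)] ev_def by simp
  have S: "- ev m * mu_poly n (gegen_monic n m * v) = - mu_poly n ([:1, 0, -1:] * (pderiv (gegen_monic n m) * pderiv v))" for m v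
    using mu_poly_ode_symmetric[OF assms(1), of "gegen_monic n m" v] unfolding E by simp
  have "ev i * mu_poly n (gegen_monic n i * gegen_monic n j) = ev j * mu_poly n (gegen_monic n j * gegen_monic n i)"
    using S[of i "gegen_monic n j"] S[of j "gegen_monic n i"] by (simp add: mult.commute del: mult_pCons_left)
  hence "(ev i - ev j) * mu_poly n (gegen_monic n i * gegen_monic n j) = 0"
    by (simp add: algebra_simps)
  moreover have "ev i - ev j = (real i - real j) * (real i + real j + real n - 2)"
    by (simp add: ev_def algebra_simps)
  moreover have "(real i - real j) * (real i + real j + real n - 2) \<noteq> 0"
    using assms by auto
  ultimately show ?thesis by simp
qed

text \<open>The basis is triangular, so the top term can be split off repeatedly. Vanishing
  coefficients instead of a degree bound admit \<open>m = 0\<close>, where \<open>f\<close> is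
  zero.\<close>

lemma gegen_monic_expansion:
  assumes "\<And>i. i \<ge> m \<Longrightarrow> coeff f i = 0"
  shows "\<exists>c. f = (\<Sum>i<m. smult (c i) (gegen_monic n i))"
  using assms
proof (induction m arbitrary: f)
  case 0
  thus ?case by (simp add: poly_eq_iff)
next
  case (Suc m)
  have "coeff (f - smult (coeff f m) (gegen_monic n m)) i = 0" if "i \<ge> m" for i
    using that Suc.prems[of i] by (cases "i = m") (auto simp: coeff_gegen_monic_ge)
  from Suc.IH[OF this] obtain c where
    c: "f - smult (coeff f m) (gegen_monic n m) = (\<Sum>i<m. smult (c i) (gegen_monic n i))" by blast
  have "f = (\<Sum>i<Suc m. smult ((c(m := coeff f m)) i) (gegen_monic n i))"
    using c by (simp add: algebra_simps)
  thus ?case by blast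
qed

lemma gegen_monic_orthogonal_low:
  assumes "n \<ge> 3" "\<And>i. i \<ge> m \<Longrightarrow> coeff f i = 0"
  shows "mu_poly n (gegen_monic n m * f) = 0"
proof -
  obtain c where "f = (\<Sum>i<m. smult (c i) (gegen_monic n i))"
    using gegen_monic_expansion assms(2) by blast
  thus ?thesis
    using gegen_monic_orthogonal[OF assms(1)] by (simp add: sum_distrib_left mu_poly_sum)
qed

text \<open>Both sides are the integral of \<open>t p\<^sub>m\<^sub>+\<^sub>1 p\<^sub>m\<close>:
  once with \<open>t p\<^sub>m\<close> replaced by \<open>p\<^sub>m\<^sub>+\<^sub>1\<close> up to
  lower degree, once with \<open>t p\<^sub>m\<^sub>+\<^sub>1\<close> replaced by the
  recurrence.\<close>

lemma gegen_monic_norm_Suc: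
  assumes "n \<ge> 3"
  shows "mu_poly n (gegen_monic n (Suc m) * gegen_monic n (Suc m)) = gegen_rec n (Suc m) * mu_poly n (gegen_monic n m * gegen_monic n m)"
proof -
  let ?p = "gegen_monic n"
  have "mu_poly n (?p (Suc (Suc m)) * ?p m) = 0"
    by (rule gegen_monic_orthogonal) (use assms in auto)
  hence "mu_poly n (([:0, 1:] * ?p (Suc m)) * ?p m) = gegen_rec n (Suc m) * mu_poly n (?p m * ?p m)"
    by (simp add: gegen_monic.simps(3) algebra_simps del: mult_pCons_left)
  moreover have "mu_poly n (?p (Suc m) * ([:0, 1:] * ?p m - ?p (Suc m))) = 0"
  proof (rule gegen_monic_orthogonal_low[OF assms])
    fix i assume "Suc m \<le> i"
    thus "coeff ([:0, 1:] * ?p m - ?p (Suc m)) i = 0"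
      by (cases "i = Suc m") (auto simp: coeff_pCons coeff_gegen_monic_ge split: nat.split)
  qed
  ultimately show ?thesis
    by (simp add: algebra_simps)
qed

section \<open>Interlacing zeros\<close>

lemma degree_lead_coeff_linear_prod:
  fixes x :: "'b \<Rightarrow> 'a :: idom"
  assumes "finite A"
  shows "degree (\<Prod>i\<in>A. [:- x i, 1:]) = card A \<and> lead_coeff (\<Prod>i\<in>A. [:- x i, 1:]) = 1"
  using assms
  using lead_coeff_prod[of "\<lambda>i. [:- x i, 1:]" A] by (simp add: degree_prod_sum_eq)

lemma poly_factor_of_roots:
  fixes R :: "'a :: idom poly"
  assumes "degree R = m" "lead_coeff R = 1" "inj_on y {..<m}" "\<And>i. i < m \<Longrightarrow> poly R (y i) = 0"
  shows "R = (\<Prod>i<m. [:- y i, 1:])"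
proof (rule poly_eqI_degree_lead_coeff[where A = "y ` {..<m}" and n = m])
  show "poly R z = poly (\<Prod>i<m. [:- y i, 1:]) z" if "z \<in> y ` {..<m}" for z
    using that assms(4) by (auto simp: poly_prod)
  show "card (y ` {..<m}) \<ge> m"
    using assms(3) by (simp add: card_image)
qed (use assms degree_lead_coeff_linear_prod[of "{..<m}" y] in auto)

lemma chain_mono:
  fixes z :: "nat \<Rightarrow> real"
  assumes "\<And>i. i < m \<Longrightarrow> z i < z (Suc i)" "i \<le> j" "j \<le> m"
  shows "z i \<le> z j"
  using assms(2,3)
proof (induction j rule: dec_induct)
  case (step j)
  thus ?case using assms(1)[of j] by simp
qed simp

text \<open>The intermediate value theorem puts a zero into each of the \<open>m\<close> gaps, and
  these zeros exhaust the degree.\<close>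

lemma poly_roots_of_alternation:
  fixes R :: "real poly" and z :: "nat \<Rightarrow> real"
  assumes R: "degree R = m" "lead_coeff R = 1"
    and z: "\<And>i. i < m \<Longrightarrow> z i < z (Suc i)"
    and sgn: "\<And>i. i \<le> m \<Longrightarrow> poly R (z i) * (- 1) ^ (m + i) > 0"
  shows "\<exists>y. (\<forall>i<m. z i < y i \<and> y i < z (Suc i)) \<and> R = (\<Prod>i<m. [:- y i, 1:])"
proof -
  have "\<exists>u. z i < u \<and> u < z (Suc i) \<and> poly R u = 0" if "i < m" for i
  proof -
    have "(poly R (z i) * (- 1) ^ (m + i)) * (poly R (z (Suc i)) * (- 1) ^ (m + Suc i)) > 0"
      by (rule mult_pos_pos[OF sgn sgn]) (use that in auto)
    moreover have "(- 1 :: real) ^ (m + i) * (- 1) ^ (m + Suc i) = - 1"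
      by (simp flip: power_mult_distrib)
    ultimately have "poly R (z i) * poly R (z (Suc i)) < 0"
      by (metis (no_types, opaque_lifting) mult.assoc mult.left_commute mult_minus1_right neg_0_less_iff_less)
    from poly_IVT[OF z[OF that] this] show ?thesis by auto
  qed
  then obtain y where y: "\<And>i. i < m \<Longrightarrow> z i < y i \<and> y i < z (Suc i) \<and> poly R (y i) = 0"
    by metis
  have mono: "z i \<le> z j" if "i \<le> j" "j \<le> m" for i j
    using that by (intro chain_mono[of m z]) (auto intro: z)
  have "y i < y j" if "i < j" "j < m" for i j
    using y[of i] y[of j] mono[of "Suc i" j] that by auto
  hence "inj_on y {..<m}"
    by (intro linorder_inj_onI) (auto, metis less_irrefl)
  from poly_factor_of_roots[OF R this] y show ?thesis by blast
qed

text \<open>Exactly \<open>m - i\<close> factors are negative at \<open>t\<close>, and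
  \<open>m + i\<close> has the same parity.\<close>

lemma sgn_prod_between:
  fixes x :: "nat \<Rightarrow> real"
  assumes "i \<le> m" "\<And>j. j < i \<Longrightarrow> x j < t" "\<And>j. i \<le> j \<Longrightarrow> j < m \<Longrightarrow> t < x j"
  shows "poly (\<Prod>j<m. [:- x j, 1:]) t * (- 1) ^ (m + i) > 0"
  using assms
proof (induction m)
  case 0
  thus ?case by simp
next
  case (Suc m)
  show ?case
  proof (cases "i = Suc m")
    case True
    have "(\<Prod>j<Suc m. t - x j) > 0"
      using Suc.prems True by (intro prod_pos) auto
    thus ?thesis using True by (simp add: poly_prod flip: mult_2 del: prod.lessThan_Suc)
  next
    case False
    hence "poly (\<Prod>j<m. [:- x j, 1:]) t * (- 1) ^ (m + i) > 0" "t < x m"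
      using Suc by auto
    hence "poly (\<Prod>j<m. [:- x j, 1:]) t * (- 1) ^ (m + i) * (x m - t) > 0" by simp
    thus ?thesis by (simp add: algebra_simps)
  qed
qed

text \<open>The points \<open>z\<close> are the zeros of \<open>P\<close> together with the endpoints of \<open>[-1, 1]\<close>.\<close>

definition interlaced :: "nat \<Rightarrow> real poly \<Rightarrow> real poly \<Rightarrow> bool" where
  "interlaced m P R \<longleftrightarrow> degree R = Suc m \<and> lead_coeff R = 1 \<and>
     (\<exists>z. z 0 = -1 \<and> z (Suc m) = 1 \<and> (\<forall>i\<le>m. z i < z (Suc i)) \<and> P = (\<Prod>i<m. [:- z (Suc i), 1:]) \<and>
        (\<forall>i\<le>Suc m. poly R (z i) * (- 1) ^ (Suc m + i) > 0))"

lemma interlaced_roots: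
  assumes "interlaced m P R"
  obtains y where "inj_on y {..<Suc m}" "\<And>i. i < Suc m \<Longrightarrow> y i \<in> {-1<..<1}" "R = (\<Prod>i<Suc m. [:- y i, 1:])"
proof -
  obtain z where R: "degree R = Suc m" "lead_coeff R = 1"
    and z: "z 0 = -1" "z (Suc m) = 1" "\<And>i. i < Suc m \<Longrightarrow> z i < z (Suc i)"
    and sgn: "\<And>i. i \<le> Suc m \<Longrightarrow> poly R (z i) * (- 1) ^ (Suc m + i) > 0"
    using assms unfolding interlaced_def by (auto simp: less_Suc_eq_le)
  obtain y where y: "\<And>i. i < Suc m \<Longrightarrow> z i < y i \<and> y i < z (Suc i)" and R': "R = (\<Prod>i<Suc m. [:- y i, 1:])"
    using poly_roots_of_alternation[OF R z(3) sgn] by blast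
  have mono: "z i \<le> z j" if "i \<le> j" "j \<le> Suc m" for i j
    using that by (intro chain_mono[of "Suc m" z]) (auto intro: z(3))
  have "y i < y j" if "i < j" "j < Suc m" for i j
    using y[of i] y[of j] mono[of "Suc i" j] that by auto
  hence "inj_on y {..<Suc m}"
    by (intro linorder_inj_onI) (auto, metis less_irrefl)
  moreover have "y i \<in> {-1<..<1}" if "i < Suc m" for i
    using y[OF that] mono[of 0 i] mono[of "Suc i" "Suc m"] that z by auto
  ultimately show thesis using that R' by blast
qed

text \<open>At a zero of \<open>R\<close> the polynomial \<open>S\<close> equals
  \<open>- b * P\<close>, and \<open>P\<close> alternates over these zeros because its own zeros
  separate them. The signs at 1 and -1 are hypotheses. With \<open>b = gegen_rec n (Suc m)\<close>
  this is the Gegenbauer recurrence; a smaller positive \<open>b\<close> yields the node polynomial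
  \<open>q\<close>.\<close>

lemma interlaced_step:
  assumes "interlaced m P R" and "b > 0"
    and S: "S = [:0, 1:] * R - smult b P"
    and "poly S 1 > 0" "poly S (- 1) * (- 1) ^ m > 0"
  shows "interlaced (Suc m) R S"
proof -
  obtain z where R: "degree R = Suc m" "lead_coeff R = 1"
    and z: "z 0 = -1" "z (Suc m) = 1" "\<And>i. i \<le> m \<Longrightarrow> z i < z (Suc i)"
    and P: "P = (\<Prod>i<m. [:- z (Suc i), 1:])"
    and sgn: "\<And>i. i \<le> Suc m \<Longrightarrow> poly R (z i) * (- 1) ^ (Suc m + i) > 0"
    using assms(1) unfolding interlaced_def by auto
  obtain y where y: "\<And>i. i \<le> m \<Longrightarrow> z i < y i \<and> y i < z (Suc i)" and R': "R = (\<Prod>i<Suc m. [:- y i, 1:])"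
    using poly_roots_of_alternation[OF R z(3) sgn] by (auto simp: less_Suc_eq_le)
  have mono: "z i \<le> z j" if "i \<le> j" "j \<le> Suc m" for i j
    using that by (intro chain_mono[of "Suc m" z]) (auto intro: z(3))
  have ymono: "y i < y (Suc i)" if "i < m" for i
    using y[of i] y[of "Suc i"] that by auto
  \<comment> \<open>The new sample points: -1, then the zeros of \<open>R\<close>, then 1.\<close>
  define w where "w i = (case i of 0 \<Rightarrow> - 1 | Suc j \<Rightarrow> if j \<le> m then y j else 1)" for i
  have w: "w 0 = -1" "w (Suc (Suc m)) = 1" "\<And>i. i \<le> m \<Longrightarrow> w (Suc i) = y i" by (auto simp: w_def)
  have "w i < w (Suc i)" if "i \<le> Suc m" for i
  proof (cases i)
    case 0
    thus ?thesis using y[of 0] z by (simp add: w)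
  next
    case (Suc j)
    thus ?thesis using that y[of m] z ymono[of j] by (cases "j = m") (auto simp: w)
  qed
  moreover have "R = (\<Prod>i<Suc m. [:- w (Suc i), 1:])"
    unfolding R' by (intro prod.cong) (auto simp: w)
  moreover have "poly S (w i) * (- 1) ^ (Suc (Suc m) + i) > 0" if i: "i \<le> Suc (Suc m)" for i
  proof -
    consider "i = 0" | "i = Suc (Suc m)" | j where "i = Suc j" "j \<le> m"
      using i by (cases i) (auto simp: le_Suc_eq)
    thus ?thesis
    proof cases
      case 3
      have "poly R (y j) = 0" using 3 by (auto simp: R' poly_prod less_Suc_eq_le simp del: prod.lessThan_Suc)
      hence "poly S (w i) = - b * poly P (y j)" by (simp add: S w 3)
      moreover have "poly P (y j) * (- 1) ^ (m + j) > 0" unfolding P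
      proof (rule sgn_prod_between)
        show "z (Suc i) < y j" if "i < j" for i
          using mono[of "Suc i" j] y[of j] that 3 by auto
        show "y j < z (Suc i)" if "j \<le> i" "i < m" for i
          using mono[of "Suc j" "Suc i"] y[of j] that 3 by auto
      qed (use 3 in auto)
      ultimately show ?thesis using \<open>b > 0\<close> 3 by (simp add: mult_less_0_iff zero_less_mult_iff)
    qed (use assms w in \<open>auto simp flip: mult_2\<close>)
  qed
  moreover have "degree S = Suc (Suc m)" "lead_coeff S = 1"
  proof -
    have RX: "degree ([:0, 1:] * R) = Suc (Suc m)" "lead_coeff ([:0, 1:] * R) = 1"
      using R by (auto simp: degree_mult_eq lead_coeff_mult)
    have dP: "degree (smult b P) < Suc (Suc m)"
      using degree_lead_coeff_linear_prod[of "{..<m}" "\<lambda>i. z (Suc i)"] degree_smult_le[of b P] by (simp add: P)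
    show d: "degree S = Suc (Suc m)"
      unfolding S diff_conv_add_uminus using RX dP by (subst degree_add_eq_left) auto
    show "lead_coeff S = 1"
      unfolding d using RX coeff_eq_0[OF dP] by (simp add: S del: mult_pCons_left)
  qed
  ultimately show ?thesis
    unfolding interlaced_def using w by blast
qed

section \<open>Hermite interpolation of absolutely monotone functions\<close>

lemma coeff_mult_second:
  assumes "degree p \<le> Suc a" "degree r \<le> Suc b"
  shows "coeff (p * r) (Suc (a + b)) = coeff p (Suc a) * coeff r b + coeff p a * coeff r (Suc b)"
proof -
  have "coeff (p * r) (Suc (a + b)) = (\<Sum>i\<in>{a, Suc a}. coeff p i * coeff r (Suc (a + b) - i))"
    unfolding coeff_mult
  proof (intro sum.mono_neutral_right ballI)
    fix i assume "i \<in> {..Suc (a + b)} - {a, Suc a}"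
    hence "i > Suc a \<or> Suc (a + b) - i > Suc b" by auto
    thus "coeff p i * coeff r (Suc (a + b) - i) = 0" using assms by (auto simp: coeff_eq_0)
  qed auto
  thus ?thesis by (simp add: add_ac)
qed

lemma coeff_mult_third:
  assumes "degree p \<le> Suc (Suc a)" "degree r \<le> Suc (Suc b)"
  shows "coeff (p * r) (Suc (Suc (a + b))) =
    coeff p (Suc (Suc a)) * coeff r b + coeff p (Suc a) * coeff r (Suc b) + coeff p a * coeff r (Suc (Suc b))"
proof -
  have "coeff (p * r) (Suc (Suc (a + b))) = (\<Sum>i\<in>{a, Suc a, Suc (Suc a)}. coeff p i * coeff r (Suc (Suc (a + b)) - i))"
    unfolding coeff_mult
  proof (intro sum.mono_neutral_right ballI)
    fix i assume "i \<in> {..Suc (Suc (a + b))} - {a, Suc a, Suc (Suc a)}"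
    hence "i > Suc (Suc a) \<or> Suc (Suc (a + b)) - i > Suc (Suc b)" by auto
    thus "coeff p i * coeff r (Suc (Suc (a + b)) - i) = 0" using assms by (auto simp: coeff_eq_0)
  qed auto
  thus ?thesis by (simp add: Suc_diff_le add_ac)
qed

text \<open>All derivatives travel as one family of real functions. The interval is half-open
  because \<open>h\<close> may be infinite at 1, and the derivative at -1 is one-sided.\<close>

definition am_derivs :: "(nat \<Rightarrow> real \<Rightarrow> real) \<Rightarrow> bool" where
  "am_derivs D \<longleftrightarrow> (\<forall>j. \<forall>t\<in>{-1..<1}. (D j has_real_derivative D (Suc j) t) (at t within {-1..<1}) \<and> 0 \<le> D j t)"

text \<open>The divided difference is \<open>\<integral> D\<^sub>1 (a + s (x - a)) ds\<close> over \<open>[0, 1]\<close>, which can be differentiated under the integral.\<close>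

lemma am_divided_difference:
  assumes D: "am_derivs D" and a: "a \<in> {-1..<1}"
  shows "\<exists>E. am_derivs E \<and> (\<forall>x\<in>{-1..<1}. D 0 x = D 0 a + (x - a) * E 0 x)"
proof -
  let ?U = "{-1..<1::real}"
  have dD: "(D j has_real_derivative D (Suc j) t) (at t within ?U)" and nn: "0 \<le> D j t" if "t \<in> ?U" for j t
    using D that unfolding am_derivs_def by auto
  have cD: "continuous_on ?U (D j)" for j
    using dD by (intro DERIV_continuous_on)
  have mem: "a + s * (x - a) \<in> ?U" if "s \<in> {0..1}" "x \<in> ?U" for s x
  proof -
    have "(1 - s) *\<^sub>R a + s *\<^sub>R x \<in> ?U"
      using convexD[OF convex_real_interval(7), of a "-1" 1 x "1 - s" s] that a by auto
    thus ?thesis by (simp add: algebra_simps)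
  qed
  have mem': "-1 \<le> a + s * (x - a)" "a + s * (x - a) < 1" if "0 \<le> s" "s \<le> 1" "-1 \<le> x" "x < 1" for s x
    using mem[of s x] that by auto
  \<comment> \<open>Each differentiation in \<open>x\<close> brings out a factor \<open>s\<close>,
    so \<open>E j\<close> is the \<open>j\<close>-th derivative of the divided difference; its
    integrand is nonnegative on [0, 1].\<close>
  define E where "E j x = integral {0..1} (\<lambda>s. s ^ j * D (Suc j) (a + s * (x - a)))" for j x
  have cE: "continuous_on {0..1} (\<lambda>s. s ^ j * D i (a + s * (x - a)))" if "x \<in> ?U" for i j x
    using that by (intro continuous_intros continuous_on_compose2[OF cD]) (auto intro: mem')
  have "(E j has_real_derivative E (Suc j) x) (at x within ?U)" if x: "x \<in> ?U" for j x
    unfolding E_def box_real[symmetric]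
  proof (rule leibniz_rule_field_derivative[OF _ _ _ x])
    fix x t :: real assume xt: "x \<in> ?U" "t \<in> cbox 0 1"
    let ?g = "\<lambda>x. a + t * (x - a)"
    have "(D (Suc j) has_real_derivative D (Suc (Suc j)) (?g x)) (at (?g x) within ?g ` ?U)"
      using xt by (intro has_field_derivative_subset[OF dD]) (auto intro: mem')
    moreover have "(?g has_real_derivative t) (at x within ?U)"
      by (auto intro!: derivative_eq_intros)
    ultimately have "(D (Suc j) \<circ> ?g has_real_derivative D (Suc (Suc j)) (?g x) * t) (at x within ?U)"
      by (rule DERIV_image_chain)
    from DERIV_cmult[OF this, of "t ^ j"]
    show "((\<lambda>x. t ^ j * D (Suc j) (?g x)) has_real_derivative t ^ Suc j * D (Suc (Suc j)) (?g x)) (at x within ?U)"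
      by (simp add: mult_ac)
  next
    fix x :: real assume "x \<in> ?U"
    thus "(\<lambda>s. s ^ j * D (Suc j) (a + s * (x - a))) integrable_on cbox 0 1"
      using cE[of x j "Suc j"] by (simp add: integrable_continuous_real)
  next
    show "continuous_on (?U \<times> cbox 0 1) (\<lambda>(x, t). t ^ Suc j * D (Suc (Suc j)) (a + t * (x - a)))"
      unfolding case_prod_beta
      by (intro continuous_intros continuous_on_compose2[OF cD]) (auto intro: mem')
  qed (rule convex_real_interval)
  moreover have "0 \<le> E j x" if "x \<in> ?U" for j x
    unfolding E_def using cE[OF that] that
    by (intro integral_nonneg integrable_continuous_real) (auto intro!: mult_nonneg_nonneg nn mem')
  ultimately have "am_derivs E" unfolding am_derivs_def by blast
  moreover have "D 0 x = D 0 a + (x - a) * E 0 x" if x: "x \<in> ?U" for x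
  proof -
    have "((\<lambda>s. (x - a) * D (Suc 0) (a + s * (x - a))) has_integral D 0 (a + 1 * (x - a)) - D 0 (a + 0 * (x - a))) {0..1}"
    proof (rule fundamental_theorem_of_calculus)
      fix s :: real assume s: "s \<in> {0..1}"
      let ?g = "\<lambda>s. a + s * (x - a)"
      have "(D 0 has_real_derivative D (Suc 0) (?g s)) (at (?g s) within ?g ` {0..1})"
        using x s by (intro has_field_derivative_subset[OF dD]) (auto intro: mem')
      moreover have "(?g has_real_derivative (x - a)) (at s within {0..1})"
        by (auto intro!: derivative_eq_intros)
      ultimately have "(D 0 \<circ> ?g has_real_derivative D (Suc 0) (?g s) * (x - a)) (at s within {0..1})"
        by (rule DERIV_image_chain)
      thus "((\<lambda>s. D 0 (?g s)) has_vector_derivative (x - a) * D (Suc 0) (?g s)) (at s within {0..1})"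
        by (simp add: o_def mult.commute has_real_derivative_iff_has_vector_derivative)
    qed simp
    from integral_unique[OF this] show ?thesis by (simp add: E_def)
  qed
  ultimately show ?thesis by blast
qed

text \<open>Two divided differences at the same point give a double node; \<open>d\<close> and
  \<open>d'\<close> are values at \<open>a\<close> of nonnegative functions.\<close>

lemma am_double:
  assumes D: "am_derivs D" and a: "a \<in> {-1..<1}"
  shows "\<exists>E d d'. am_derivs E \<and> d \<ge> 0 \<and> d' \<ge> 0 \<and> (\<forall>x\<in>{-1..<1}. D 0 x = d + d' * (x - a) + (x - a)\<^sup>2 * E 0 x)"
proof -
  obtain E where E: "am_derivs E" "\<And>x. x \<in> {-1..<1} \<Longrightarrow> D 0 x = D 0 a + (x - a) * E 0 x"
    using am_divided_difference[OF assms] by blast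
  obtain F where F: "am_derivs F" "\<And>x. x \<in> {-1..<1} \<Longrightarrow> E 0 x = E 0 a + (x - a) * F 0 x"
    using am_divided_difference[OF E(1) a] by blast
  have "D 0 x = D 0 a + E 0 a * (x - a) + (x - a)\<^sup>2 * F 0 x" if "x \<in> {-1..<1}" for x
    unfolding E(2)[OF that] F(2)[OF that] by (simp add: algebra_simps power2_eq_square)
  moreover have "D 0 a \<ge> 0" "E 0 a \<ge> 0" using D E(1) a unfolding am_derivs_def by auto
  ultimately show ?thesis using F(1) by blast
qed

text \<open>Newton interpolation with doubled nodes, one node at a time: the remainder factor is
  again absolutely monotone, so \<open>am_double\<close> applies to it at the next node.\<close>

lemma am_hermite:
  assumes "finite A" "\<And>i. i \<in> A \<Longrightarrow> y i \<in> {-1..<1}" "am_derivs D"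
  shows "\<exists>E H. am_derivs E \<and> (\<forall>i\<ge>2 * card A. coeff H i = 0) \<and>
    (\<forall>x\<in>{-1..<1}. D 0 x = poly H x + (poly (\<Prod>i\<in>A. [:- y i, 1:]) x)\<^sup>2 * E 0 x)"
  using assms
proof (induction A rule: finite_induct)
  case empty
  thus ?case by (intro exI[of _ D] exI[of _ 0]) auto
next
  case (insert a A)
  let ?v = "\<Prod>i\<in>A. [:- y i, 1:]"
  obtain E H where E: "am_derivs E" and H: "\<And>i. i \<ge> 2 * card A \<Longrightarrow> coeff H i = 0"
    and eq: "\<And>x. x \<in> {-1..<1} \<Longrightarrow> D 0 x = poly H x + (poly ?v x)\<^sup>2 * E 0 x"
    using insert.IH[OF insert.prems(1)[OF insertI2] insert.prems(2)] by blast
  obtain F d d' where F: "am_derivs F" "\<And>x. x \<in> {-1..<1} \<Longrightarrow> E 0 x = d + d' * (x - y a) + (x - y a)\<^sup>2 * F 0 x"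
    using am_double[OF E insert.prems(1)[OF insertI1]] by blast
  \<comment> \<open>The Newton increment: the squared old node polynomial times the linear part of
    \<open>E 0\<close> at \<open>y a\<close>.\<close>
  define W where "W = ?v * ?v * [:d - d' * y a, d':]"
  define K where "K = H + W"
  have dv: "degree ?v = card A" by (simp add: degree_prod_sum_eq)
  have dW: "degree W \<le> (card A + card A) + 1"
    unfolding W_def by (intro order.trans[OF degree_mult_le] add_mono) (auto simp: dv)
  have "coeff K i = 0" if "i \<ge> 2 * card (insert a A)" for i
  proof -
    have "i \<ge> 2 * card A + 2" using that insert by simp
    thus ?thesis using H[of i] dW by (simp add: K_def coeff_eq_0)
  qed
  moreover have "D 0 x = poly K x + (poly (\<Prod>i\<in>insert a A. [:- y i, 1:]) x)\<^sup>2 * F 0 x" if "x \<in> {-1..<1}" for x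
    unfolding eq[OF that] F(2)[OF that] using insert by (simp add: K_def W_def algebra_simps power2_eq_square)
  ultimately show ?case using F(1) by blast
qed

text \<open>The node \<open>y m\<close> is inserted last. Then \<open>H\<close> has degree at most
  \<open>2 * l + 1\<close>, and the coefficient of index \<open>2 * l + 2\<close> in the interpolant
  is \<open>d + d' * y m\<close>. The remainder is \<open>q\<close> squared times a nonnegative
  function, which gives the upper bound by \<open>D 0\<close>.\<close>

lemma am_hermite_minorant:
  assumes y: "\<And>i. i < Suc (Suc l) \<Longrightarrow> y i \<in> {-1..<1}" and D: "am_derivs D"
    and q: "q = (\<Prod>i<Suc (Suc l). [:- y i, 1:])" "coeff q (Suc l) = 0"
    and m: "m < Suc (Suc l)" "y m \<ge> 0"
  shows "\<exists>H. (\<forall>i\<ge>2 * l + 4. coeff H i = 0) \<and> coeff H (2 * l + 2) \<ge> 0 \<and>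
    (\<forall>i<Suc (Suc l). poly H (y i) = D 0 (y i)) \<and> (\<forall>x\<in>{-1..<1}. poly H x \<le> D 0 x)"
proof -
  define A where "A = {..<Suc (Suc l)} - {m}"
  define v where "v = (\<Prod>i\<in>A. [:- y i, 1:])"
  have cA: "card A = Suc l" "finite A" using m by (auto simp: A_def card_Diff_singleton)
  have qv: "q = [:- y m, 1:] * v"
    unfolding q(1) v_def A_def using m by (subst prod.remove[of _ m]) auto
  have dv: "degree v = Suc l" "coeff v (Suc l) = 1"
    using cA lead_coeff_prod[of "\<lambda>i. [:- y i, 1:]" A] by (auto simp: v_def degree_prod_sum_eq)
  \<comment> \<open>The nodes sum to 0, so those remaining in \<open>v\<close> sum to
    \<open>- y m\<close>.\<close>
  have vl: "coeff v l = y m" using q(2) dv by (simp add: qv)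
  have dq: "degree q \<le> Suc (Suc l)" "coeff q (Suc (Suc l)) = 1"
    using degree_mult_le[of "[:- y m, 1:]" v] dv by (simp_all add: qv coeff_eq_0)
  obtain E H where E: "am_derivs E" and H: "\<And>i. i \<ge> 2 * Suc l \<Longrightarrow> coeff H i = 0"
    and eq: "\<And>x. x \<in> {-1..<1} \<Longrightarrow> D 0 x = poly H x + (poly v x)\<^sup>2 * E 0 x"
  proof -
    have yA: "y i \<in> {-1..<1}" if "i \<in> A" for i using y that by (simp add: A_def)
    from am_hermite[of A y D, OF cA(2) yA D] that show thesis unfolding v_def[symmetric] cA by blast
  qed
  obtain F d d' where F: "am_derivs F" "d \<ge> 0" "d' \<ge> 0"
      "\<And>x. x \<in> {-1..<1} \<Longrightarrow> E 0 x = d + d' * (x - y m) + (x - y m)\<^sup>2 * F 0 x"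
    using am_double[OF E y[OF m(1)]] by blast
  define K where "K = H + smult d (v * v) + smult d' (v * q)"
  have eqK: "D 0 x = poly K x + (poly q x)\<^sup>2 * F 0 x" if "x \<in> {-1..<1}" for x
    unfolding eq[OF that] F(4)[OF that] by (simp add: K_def qv algebra_simps power2_eq_square)
  have "coeff K i = 0" if "i \<ge> 2 * l + 4" for i
  proof -
    have "degree (v * v) < i" "degree (v * q) < i"
      using that dv dq by (auto intro!: le_less_trans[OF degree_mult_le])
    thus ?thesis using that by (simp add: K_def H coeff_eq_0)
  qed
  moreover have "coeff K (2 * l + 2) \<ge> 0"
  proof -
    have "coeff (v * v) (2 * l + 2) = 1"
      using coeff_mult_degree_sum[of v v] dv by (simp add: mult_2)
    moreover have "coeff (v * q) (2 * l + 2) = y m"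
      using coeff_mult_second[of v l q "Suc l"] dv dq q(2) vl by (simp add: mult_2)
    ultimately show ?thesis using F(2,3) m(2) H[of "2 * l + 2"] by (simp add: K_def)
  qed
  moreover have "poly K (y i) = D 0 (y i)" if "i < Suc (Suc l)" for i
  proof -
    have "poly q (y i) = 0" using that unfolding q(1) poly_prod by (intro prod_zero) auto
    thus ?thesis using eqK[OF y[OF that]] by simp
  qed
  moreover have "poly K x \<le> D 0 x" if "x \<in> {-1..<1}" for x
  proof -
    have "0 \<le> F 0 x" using F(1) that unfolding am_derivs_def by blast
    thus ?thesis using eqK[OF that] by simp
  qed
  ultimately show ?thesis by blast
qed

section \<open>Extended real values and the endpoint 1\<close>

lemma abs_monotone_derivs:
  assumes "abs_monotone h"
  shows "\<exists>D. am_derivs D \<and> (\<forall>t\<in>{-1..<1}. h t = ereal (D 0 t))"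
proof -
  have nn: "\<forall>t\<in>{-1..1}. 0 \<le> h t" and fin: "\<forall>t\<in>{-1..<1}. h t \<noteq> \<infinity>"
    and ex: "\<exists>D :: nat \<Rightarrow> real \<Rightarrow> real. (\<forall>t\<in>{-1..<1}. D 0 t = real_of_ereal (h t)) \<and>
        (\<forall>j. \<forall>t\<in>{-1..<1}. (D j has_real_derivative D (Suc j) t) (at t within {-1..<1})) \<and>
        (\<forall>j. \<forall>t\<in>{-1..<1}. 0 \<le> D j t)"
    using assms unfolding abs_monotone_def by - (elim conjE, assumption)+
  from ex obtain D where D0: "\<forall>t\<in>{-1..<1}. D 0 t = real_of_ereal (h t)" and D: "am_derivs D"
    unfolding am_derivs_def by blast
  have "h t = ereal (D 0 t)" if "t \<in> {-1..<1}" for t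
  proof -
    have "t \<in> {-1..1}" using that by simp
    hence "0 \<le> h t" "h t \<noteq> \<infinity>" "D 0 t = real_of_ereal (h t)"
      using nn fin D0 that by blast+
    thus ?thesis by (cases "h t") auto
  qed
  thus ?thesis using D by blast
qed

text \<open>Only \<open>t = 1\<close> is new. Continuity of \<open>h\<close> as an extended real
  function carries the inequality to the limit, also when \<open>h 1\<close> is infinite.\<close>

lemma abs_monotone_minorantI:
  assumes h: "abs_monotone h" and le: "\<And>t. t \<in> {-1..<1} \<Longrightarrow> ereal (poly f t) \<le> h t"
    and t: "t \<in> {-1..1}"
  shows "ereal (poly f t) \<le> h t"
proof (cases "t = 1")
  case True
  have "continuous_on {-1..1} h" using h by (simp add: abs_monotone_def)
  hence "(h \<longlongrightarrow> h 1) (at 1 within {-1..1})" by (simp add: continuous_on_def)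
  hence 1: "(h \<longlongrightarrow> h 1) (at 1 within {-1..<1})"
    by (rule tendsto_within_subset) auto
  have 2: "((\<lambda>t. ereal (poly f t)) \<longlongrightarrow> ereal (poly f 1)) (at 1 within {-1..<1})"
    by (intro tendsto_intros)
  have 3: "\<forall>\<^sub>F t in at 1 within {-1..<1}. ereal (poly f t) \<le> h t"
    using le by (simp add: eventually_at_filter)
  have 4: "at 1 within {-1..<1::real} \<noteq> bot"
    by (simp add: at_within_eq_bot_iff)
  show ?thesis using tendsto_le[OF 4 1 2 3] True by simp
next
  case False
  thus ?thesis using t by (intro le) auto
qed

section \<open>The quadrature rule\<close>

lemma neg_one_power_conj: "(- 1) ^ m * x * (- 1) ^ m = (x :: real)"
  by (cases "even m") auto

text \<open>The recurrence is an instance of \<open>interlaced_step\<close>; the signs at the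
  endpoints come from positivity at 1 and parity.\<close>

lemma interlaced_gegen_monic:
  assumes "n \<ge> 3"
  shows "interlaced m (gegen_monic n m) (gegen_monic n (Suc m))"
proof (induction m)
  case 0
  show ?case unfolding interlaced_def
    \<comment> \<open>The constant polynomial has no zeros, so only the endpoints remain.\<close>
    by (intro conjI exI[of _ "\<lambda>i. if i = 0 then - 1 else 1"]) (auto simp: le_Suc_eq)
next
  case (Suc m)
  show ?case
  proof (rule interlaced_step[OF Suc gegen_rec_pos[OF assms, of m]])
    show "poly (gegen_monic n (Suc (Suc m))) (- 1) * (- 1) ^ m > 0"
      using gegen_monic_at_1[OF assms, of "Suc (Suc m)"] gegen_monic_minus[of n "Suc (Suc m)" 1]
      by (simp add: neg_one_power_conj)
  qed (rule gegen_monic.simps(3), rule gegen_monic_at_1[OF assms])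
qed

text \<open>The constant \<open>d\<close> of the header: \<open>p\<^sub>k\<^sub>+\<^sub>1\<^sup>2 - p\<^sub>2\<^sub>k\<^sub>+\<^sub>2\<close> has leading term \<open>d t\<^sup>2\<^sup>k\<close>.\<close>

definition quad_shift :: "nat \<Rightarrow> nat \<Rightarrow> real" where
  "quad_shift n k = 2 * coeff (gegen_monic n (Suc k)) (k - 1) - coeff (gegen_monic n (2 * k + 2)) (2 * k)"

lemma quad_shift_eq:
  assumes "n \<ge> 3" "k \<ge> 1"
  shows "quad_shift n k = (real k + 1)\<^sup>2 * (real n - 2) / ((4 * real k + real n) * (2 * real k + real n - 2))"
proof -
  obtain l where k: "k = Suc l" using assms by (cases k) auto
  have pos: "2 * real k + real n - 2 \<noteq> 0" "4 * real k + real n \<noteq> 0" using assms by auto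
  have 1: "coeff (gegen_monic n (Suc k)) (k - 1) = - ((real k + 1) * real k) / (2 * (2 * real k + real n - 2))"
    using coeff_gegen_monic_third[OF assms(1), of l] by (simp add: k algebra_simps)
  have 2: "coeff (gegen_monic n (2 * k + 2)) (2 * k) = - ((real k + 1) * (2 * real k + 1)) / (4 * real k + real n)"
    using coeff_gegen_monic_third[OF assms(1), of "2 * k"] pos
    by (simp add: divide_simps) (simp add: algebra_simps)
  show ?thesis unfolding quad_shift_def 1 2 using pos
    by (simp add: divide_simps) (simp add: algebra_simps power2_eq_square)
qed

lemma quad_shift_pos: "n \<ge> 3 \<Longrightarrow> k \<ge> 1 \<Longrightarrow> quad_shift n k > 0"
  unfolding quad_shift_eq by (intro divide_pos_pos mult_pos_pos) auto

text \<open>With \<open>u = 2 * x + N - 4\<close> all denominators are products of \<open>u\<close>,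
  \<open>u + 2\<close>, \<open>u + 4\<close> and \<open>u + 4 + 2 * x\<close>. After cancelling the
  common factor \<open>(N - 2) / (u + 2)\<close>, the claim follows from \<open>N - 4 < u\<close>
  and \<open>4 * x + N \<le> (x + 1)\<^sup>2 * (2 * x + N)\<close>.\<close>

lemma gegen_rec_less_shift:
  assumes "n \<ge> 3" "k \<ge> 1"
  shows "gegen_rec n (Suc k) < gegen_rec n k + quad_shift n k"
proof -
  define x N where "x = real k" and "N = real n"
  have x: "x \<ge> 1" "N \<ge> 3" using assms by (auto simp: x_def N_def)
  define u where "u = 2 * x + N - 4"
  have pos: "u > 0" "u + 2 > 0" "u + 4 > 0" "u + 4 + 2 * x > 0" using x by (auto simp: u_def)
  have "(N - 4) * (4 * x + N) < u * (4 * x + N)"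
    using x by (intro mult_strict_right_mono) (auto simp: u_def)
  also have "\<dots> \<le> u * ((x + 1)\<^sup>2 * (2 * x + N))"
  proof (intro mult_left_mono)
    have *: "(x + 1)\<^sup>2 * (2 * x + N) - (4 * x + N)
        = 2 * (x * x * x) + N * (x * x) + 2 * (x * x) + 2 * (x * x - x) + 2 * (N * x)"
      by (simp add: algebra_simps power2_eq_square)
    have "x * 1 \<le> x * x" using x by (intro mult_left_mono) auto
    hence "0 \<le> (x + 1)\<^sup>2 * (2 * x + N) - (4 * x + N)"
      unfolding * using x by (intro add_nonneg_nonneg) auto
    thus "4 * x + N \<le> (x + 1)\<^sup>2 * (2 * x + N)" by (simp only: diff_ge_0_iff_ge)
  qed (use pos in simp)
  finally have *: "(N - 4) * (u + 4 + 2 * x) < (x + 1)\<^sup>2 * u * (u + 4)"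
    by (simp add: u_def algebra_simps)
  have "gegen_rec n (Suc k) - gegen_rec n k = (N - 2) * (N - 4) / (u * (u + 2) * (u + 4))"
  proof -
    have r: "gegen_rec n (Suc k) = (x + 1) * (x + N - 2) / ((u + 4) * (u + 2))"
      "gegen_rec n k = x * (x + N - 3) / ((u + 2) * u)"
      by (simp_all add: gegen_rec_def x_def N_def u_def algebra_simps)
    have N: "N = u - 2 * x + 4" by (simp add: u_def)
    show ?thesis unfolding r N using pos by (simp add: divide_simps) (simp add: algebra_simps)
  qed
  also have "\<dots> = (N - 2) / (u + 2) * ((N - 4) / (u * (u + 4)))" by simp
  also have "\<dots> < (N - 2) / (u + 2) * ((x + 1)\<^sup>2 / (u + 4 + 2 * x))"
    using * pos x by (intro mult_strict_left_mono divide_pos_pos) (simp_all add: divide_simps mult_ac)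
  also have "\<dots> = quad_shift n k"
    unfolding quad_shift_eq[OF assms] by (simp add: x_def N_def u_def algebra_simps)
  finally show ?thesis by simp
qed

text \<open>Intermediate value theorem: the quadratic is 0 at 0, and by
  \<open>gegen_rec_less_shift\<close> it exceeds the target at \<open>gegen_rec n k\<close>. Both
  comparisons are strict, so \<open>c\<close> is not an endpoint.\<close>

lemma quad_param_exists:
  assumes "n \<ge> 3" "k \<ge> 1"
  shows "\<exists>c. 0 < c \<and> c < gegen_rec n k \<and> c\<^sup>2 + quad_shift n k * c = gegen_rec n (Suc k) * gegen_rec n k"
proof -
  let ?b = "gegen_rec n k" and ?f = "\<lambda>c. c\<^sup>2 + quad_shift n k * c"
  have b: "?b > 0" "gegen_rec n (Suc k) > 0"
    using gegen_rec_pos[OF assms(1), of "k - 1"] gegen_rec_pos[OF assms(1), of k] assms by auto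
  have lt: "gegen_rec n (Suc k) * ?b < ?f ?b"
    using mult_strict_right_mono[OF gegen_rec_less_shift[OF assms] b(1)] by (simp add: algebra_simps power2_eq_square)
  have "\<exists>c\<ge>0. c \<le> ?b \<and> ?f c = gegen_rec n (Suc k) * ?b"
    using b lt by (intro IVT') (auto intro!: continuous_intros)
  then obtain c where c: "c \<ge> 0" "c \<le> ?b" "?f c = gegen_rec n (Suc k) * ?b" by blast
  moreover have "c \<noteq> 0" using c b by auto
  moreover have "c \<noteq> ?b" using c lt by auto
  ultimately show ?thesis by (intro exI[of _ c]) auto
qed

section \<open>Interpolatory quadrature\<close>

definition quad :: "nat \<Rightarrow> (nat \<Rightarrow> real) \<Rightarrow> (nat \<Rightarrow> real) \<Rightarrow> real poly \<Rightarrow> real" where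
  "quad m y \<rho> f = (\<Sum>i<m. \<rho> i * poly f (y i))"

lemma quad_add [simp]: "quad m y \<rho> (f + g) = quad m y \<rho> f + quad m y \<rho> g"
  by (simp add: quad_def algebra_simps sum.distrib)

lemma quad_diff [simp]: "quad m y \<rho> (f - g) = quad m y \<rho> f - quad m y \<rho> g"
  by (simp add: quad_def algebra_simps sum_subtractf)

lemma quad_smult [simp]: "quad m y \<rho> (smult c f) = c * quad m y \<rho> f"
  by (simp add: quad_def sum_distrib_left mult_ac)

lemma quad_0 [simp]: "quad m y \<rho> 0 = 0"
  by (simp add: quad_def)

lemma quad_sum: "quad m y \<rho> (sum f A) = (\<Sum>i\<in>A. quad m y \<rho> (f i))"
  by (induction A rule: infinite_finite_induct) auto

text \<open>The weights are the integrals of the Lagrange basis polynomials.\<close>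

lemma interpolatory_weights_exist:
  assumes inj: "inj_on y {..<m}"
  shows "\<exists>\<rho>. \<forall>f. degree f < m \<longrightarrow> mu_poly n f = quad m y \<rho> f"
proof -
  define L where "L i = smult (1 / (\<Prod>j\<in>{..<m}-{i}. y i - y j)) (\<Prod>j\<in>{..<m}-{i}. [:- y j, 1:])" for i
  have dL: "degree (L i) < m" if "i < m" for i
    using that by (auto simp: L_def degree_prod_sum_eq intro!: le_less_trans[OF degree_smult_le])
  have L: "poly (L i) (y j) = (if i = j then 1 else 0)" if "i < m" "j < m" for i j
  proof (cases "i = j")
    case True
    have "(\<Prod>j\<in>{..<m}-{i}. y i - y j) \<noteq> 0"
      using inj_onD[OF inj] that by auto
    thus ?thesis using True by (simp add: L_def poly_prod)
  next
    case False
    have "(\<Prod>t\<in>{..<m}-{i}. y j - y t) = 0"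
      using that False by (intro prod_zero) auto
    thus ?thesis using False by (simp add: L_def poly_prod)
  qed
  have "mu_poly n f = quad m y (\<lambda>i. mu_poly n (L i)) f" if f: "degree f < m" for f
  proof -
    have "f = (\<Sum>i<m. smult (poly f (y i)) (L i))"
    proof (rule poly_eqI_degree[where A = "y ` {..<m}"])
      fix x assume "x \<in> y ` {..<m}"
      then obtain j where j: "x = y j" "j < m" by auto
      have "(\<Sum>i<m. poly f (y i) * poly (L i) (y j)) = (\<Sum>i<m. if i = j then poly f (y j) else 0)"
        using j L by (intro sum.cong) auto
      thus "poly f x = poly (\<Sum>i<m. smult (poly f (y i)) (L i)) x"
        using j by (simp add: poly_sum)
    next
      show "card (y ` {..<m}) > degree f" using f inj by (simp add: card_image)
      have "degree (\<Sum>i<m. smult (poly f (y i)) (L i)) < m"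
        using f dL by (intro degree_sum_less) (auto intro: le_less_trans[OF degree_smult_le])
      thus "card (y ` {..<m}) > degree (\<Sum>i<m. smult (poly f (y i)) (L i))"
        using inj by (simp add: card_image)
    qed
    hence "mu_poly n f = mu_poly n (\<Sum>i<m. smult (poly f (y i)) (L i))" by (rule arg_cong)
    thus ?thesis by (simp add: mu_poly_sum quad_def mult.commute)
  qed
  thus ?thesis by blast
qed

text \<open>Here \<open>k = l + 1\<close>, which avoids truncated subtraction in the indices.\<close>

locale gegen_quadrature =
  fixes n l :: nat and c :: real and y \<rho> :: "nat \<Rightarrow> real"
  assumes n: "n \<ge> 3" and c_pos: "c > 0" and c_less: "c < gegen_rec n (Suc l)"
    and c_eq: "c\<^sup>2 + quad_shift n (Suc l) * c = gegen_rec n (Suc (Suc l)) * gegen_rec n (Suc l)"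
    and inj: "inj_on y {..<Suc (Suc l)}"
    and roots: "gegen_monic n (Suc (Suc l)) + smult c (gegen_monic n l) = (\<Prod>i<Suc (Suc l). [:- y i, 1:])"
    and interpolatory: "degree f < Suc (Suc l) \<Longrightarrow> mu_poly n f = quad (Suc (Suc l)) y \<rho> f"
begin

abbreviation "p \<equiv> gegen_monic n"
abbreviation "Q \<equiv> quad (Suc (Suc l)) y \<rho>"
definition "q = p (Suc (Suc l)) + smult c (p l)"

section \<open>The node polynomial, exactness and positivity of the weights\<close>

lemma q_eq: "q = [:0, 1:] * p (Suc l) - smult (gegen_rec n (Suc l) - c) (p l)"
  by (simp add: q_def gegen_monic.simps(3) smult_diff_left)

lemma q_prod: "q = (\<Prod>i<Suc (Suc l). [:- y i, 1:])"
  by (simp only: q_def roots)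

lemma degree_q: "degree q = Suc (Suc l)" "coeff q (Suc (Suc l)) = 1"
  "coeff q (Suc l) = 0" "coeff q l = coeff (p (Suc (Suc l))) l + c"
proof -
  show 1: "coeff q (Suc (Suc l)) = 1" "coeff q (Suc l) = 0" "coeff q l = coeff (p (Suc (Suc l))) l + c"
    by (simp_all add: q_def coeff_gegen_monic_ge)
  have "degree q \<le> Suc (Suc l)"
    unfolding q_def by (intro degree_add_le order.trans[OF degree_smult_le]) auto
  with 1 show "degree q = Suc (Suc l)" using le_degree[of q "Suc (Suc l)"] by simp
qed

lemma q_root: "i < Suc (Suc l) \<Longrightarrow> poly q (y i) = 0"
  unfolding q_prod poly_prod by (intro prod_zero) auto

text \<open>The term \<open>smult c (p l)\<close> restricts orthogonality to degree below
  \<open>l\<close>; the rule thus reaches degree \<open>2 * l + 1\<close> only.\<close>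

lemma mu_q: 
  assumes "\<And>i. i \<ge> l \<Longrightarrow> coeff f i = 0"
  shows "mu_poly n (q * f) = 0"
  using gegen_monic_orthogonal_low[OF n, of "Suc (Suc l)" f] gegen_monic_orthogonal_low[OF n, of l f] assms
  by (simp add: q_def distrib_right)

lemma Q_q: "Q (q * f) = 0"
  unfolding quad_def by (intro sum.neutral) (simp add: q_root)

text \<open>Gauss's argument: after division by \<open>q\<close>, both functionals annihilate
  \<open>q * s\<close> and agree on the remainder.\<close>

lemma exact:
  assumes "degree f < 2 * l + 2"
  shows "Q f = mu_poly n f"
proof -
  define s r where "s = f div q" and "r = f mod q"
  have f: "f = q * s + r" by (simp add: s_def r_def)
  have "q \<noteq> 0" using degree_q by auto
  hence r: "degree r < Suc (Suc l)"
    using degree_mod_less[of q f] degree_q(1) by (auto simp: r_def)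
  \<comment> \<open>The quotient has degree below \<open>l\<close>; for \<open>l = 0\<close> it is
    zero.\<close>
  have "coeff s i = 0" if "i \<ge> l" for i
  proof (cases "s = 0")
    case False
    hence "degree (q * s) = Suc (Suc l) + degree s"
      using \<open>q \<noteq> 0\<close> by (simp add: degree_mult_eq degree_q)
    hence "degree f = Suc (Suc l) + degree s"
      unfolding f using r by (subst degree_add_eq_left) auto
    thus ?thesis using assms that by (intro coeff_eq_0) auto
  qed simp
  hence "mu_poly n (q * s) = 0" by (rule mu_q)
  thus ?thesis using interpolatory[OF r] unfolding f by (simp add: Q_q)
qed

lemma degree_mult_less: "degree f + degree g < m \<Longrightarrow> degree (f * g) < m"
  using degree_mult_le le_less_trans by blast

text \<open>One factor \<open>p (Suc l)\<close> may be exchanged for \<open>t\<close> times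
  \<open>p l\<close>: the error lies within exact degree and has integral zero. By
  \<open>q_eq\<close>, \<open>t\<close> times \<open>p (Suc l)\<close> is then a multiple of
  \<open>p l\<close> modulo \<open>q\<close>, which vanishes at the nodes.\<close>

lemma Q_middle: "Q (p (Suc l) * p (Suc l)) = (gegen_rec n (Suc l) - c) * mu_poly n (p l * p l)"
proof -
  have d: "degree (p (Suc l) - [:0, 1:] * p l) \<le> l"
  proof (rule degree_le, intro allI impI)
    fix i assume "l < i"
    thus "coeff (p (Suc l) - [:0, 1:] * p l) i = 0"
      by (cases "i = Suc l") (auto simp: coeff_pCons coeff_gegen_monic_ge split: nat.split)
  qed
  have "degree (p (Suc l) * (p (Suc l) - [:0, 1:] * p l)) < 2 * l + 2"
    using d by (intro degree_mult_less) simp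
  hence "Q (p (Suc l) * (p (Suc l) - [:0, 1:] * p l)) = mu_poly n (p (Suc l) * (p (Suc l) - [:0, 1:] * p l))"
    by (rule exact)
  also have "\<dots> = 0"
    by (rule gegen_monic_orthogonal_low[OF n], rule coeff_eq_0) (use d in linarith)
  finally have "Q (p (Suc l) * p (Suc l)) = Q (([:0, 1:] * p (Suc l)) * p l)"
    by (simp add: algebra_simps)
  also have "[:0, 1:] * p (Suc l) = q + smult (gegen_rec n (Suc l) - c) (p l)"
    by (simp add: q_eq)
  also have "Q (\<dots> * p l) = (gegen_rec n (Suc l) - c) * mu_poly n (p l * p l)"
    using Q_q[of "p l"] exact[OF degree_mult_less, of "p l" "p l"] by (simp add: distrib_right)
  finally show ?thesis .
qed

lemma norm_pos: "mu_poly n (p m * p m) > 0"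
  by (rule mu_poly_square_pos) (metis coeff_0 coeff_gegen_monic_lead zero_neq_one)

text \<open>The square may have degree \<open>2 * l + 2\<close>, just beyond exactness. Splitting
  off the \<open>p (Suc l)\<close> component leaves no cross term; \<open>Q_middle\<close> and
  \<open>c_less\<close> handle the leading part, the integral the rest.\<close>

lemma Q_square_pos:
  assumes "g \<noteq> 0" "degree g < Suc (Suc l)"
  shows "Q (g * g) > 0"
proof -
  define a r where "a = coeff g (Suc l)" and "r = g - smult a (p (Suc l))"
  have g: "g = smult a (p (Suc l)) + r" by (simp add: r_def)
  have r: "coeff r i = 0" if "i > l" for i
    using that assms(2) by (cases "i = Suc l") (auto simp: r_def a_def coeff_eq_0 coeff_gegen_monic_ge)
  hence dr: "degree r \<le> l" by (intro degree_le) auto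
  have "Q (p (Suc l) * r) = mu_poly n (p (Suc l) * r)"
    using dr by (intro exact degree_mult_less) simp
  also have "\<dots> = 0" by (rule gegen_monic_orthogonal_low[OF n]) (use r in auto)
  finally have "Q (p (Suc l) * r) = 0" .
  moreover have "Q (r * r) = mu_poly n (r * r)"
    using dr by (intro exact degree_mult_less) simp
  moreover have "g * g = smult (a * a) (p (Suc l) * p (Suc l)) + smult a (p (Suc l) * r) + smult a (p (Suc l) * r) + r * r"
    unfolding g by (simp add: algebra_simps)
  ultimately have eq: "Q (g * g) = a * a * Q (p (Suc l) * p (Suc l)) + mu_poly n (r * r)"
    by (simp only: quad_add quad_smult mult_zero_right add_0_right)
  have "Q (p (Suc l) * p (Suc l)) > 0"
    unfolding Q_middle using c_less norm_pos by simp
  hence pos: "a * a * Q (p (Suc l) * p (Suc l)) > 0" if "a \<noteq> 0"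
    using that by (auto simp: zero_less_mult_iff linorder_neq_iff)
  show ?thesis
  proof (cases "a = 0")
    case True
    hence "r \<noteq> 0" using assms(1) g by auto
    thus ?thesis unfolding eq using True mu_poly_square_pos[of r n] by simp
  next
    case False
    thus ?thesis unfolding eq using pos mu_poly_square_nonneg[of n r] by (intro add_pos_nonneg)
  qed
qed

text \<open>The square of the node polynomial without its factor at \<open>y i\<close> isolates
  \<open>\<rho> i\<close>.\<close>

lemma weight_gt_0:
  assumes "i < Suc (Suc l)"
  shows "\<rho> i > 0"
proof -
  define g where "g = (\<Prod>j\<in>{..<Suc (Suc l)}-{i}. [:- y j, 1:])"
  have "degree g = Suc l"
    using assms by (simp add: g_def degree_prod_sum_eq card_Diff_singleton)
  hence "Q (g * g) > 0" by (intro Q_square_pos) auto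
  also have "Q (g * g) = (\<Sum>j<Suc (Suc l). if j = i then \<rho> i * (poly g (y i))\<^sup>2 else 0)"
    unfolding quad_def
  proof (intro sum.cong refl)
    fix j assume j: "j \<in> {..<Suc (Suc l)}"
    have "poly g (y j) = 0" if "j \<noteq> i"
      unfolding g_def poly_prod using that j by (intro prod_zero) auto
    thus "\<rho> j * poly (g * g) (y j) = (if j = i then \<rho> i * (poly g (y i))\<^sup>2 else 0)"
      by (simp add: power2_eq_square)
  qed
  also have "\<dots> = \<rho> i * (poly g (y i))\<^sup>2" using assms by (simp del: sum.lessThan_Suc)
  finally show ?thesis by (simp add: zero_less_mult_iff)
qed

text \<open>The weights sum to 1, and there are at least two of them, all positive.\<close>

lemma weight_less_1:
  assumes "i < Suc (Suc l)"
  shows "\<rho> i < 1"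
proof -
  have "(\<Sum>j<Suc (Suc l). \<rho> j) = 1"
    using exact[of 1] by (simp add: quad_def del: sum.lessThan_Suc)
  hence "\<rho> i + (\<Sum>j\<in>{..<Suc (Suc l)}-{i}. \<rho> j) = 1"
    using sum.remove[of "{..<Suc (Suc l)}" i \<rho>] assms by simp
  moreover have "(\<Sum>j\<in>{..<Suc (Suc l)}-{i}. \<rho> j) > 0"
  proof (rule sum_pos)
    show "{..<Suc (Suc l)}-{i} \<noteq> {}"
      using assms by (cases "i = 0") (auto simp: set_eq_iff)
  qed (use weight_gt_0 in auto)
  ultimately show ?thesis by simp
qed

text \<open>Modulo \<open>q * p (Suc l)\<close>, which both functionals annihilate, this polynomial
  has degree at most \<open>2 * l + 1\<close>, since neither has a term of index
  \<open>2 * l + 2\<close>.\<close>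

lemma Q_odd: "Q (p (2 * l + 3)) = 0"
proof -
  let ?f = "p (2 * l + 3) - q * p (Suc l)"
  have "coeff ?f i = 0" if "i > 2 * l + 1" for i
  proof -
    consider "i = 2 * l + 2" | "i = 2 * l + 3" | "i > 2 * l + 3" using \<open>i > 2 * l + 1\<close> by linarith
    thus ?thesis
    proof cases
      case 1
      have "coeff (q * p (Suc l)) (2 * l + 2) = 0"
        using coeff_mult_second[of q "Suc l" "p (Suc l)" l] degree_q by (simp add: mult_2)
      thus ?thesis using 1 coeff_gegen_monic_second[of n "2 * l + 2"] by (simp add: eval_nat_numeral)
    next
      case 2
      have "coeff (q * p (Suc l)) (2 * l + 3) = 1"
        using coeff_mult_degree_sum[of q "p (Suc l)"] degree_q by (simp add: mult_2 eval_nat_numeral)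
      thus ?thesis using 2 by simp
    next
      case 3
      have "degree (q * p (Suc l)) < i" using 3 degree_q by (intro degree_mult_less) auto
      thus ?thesis using 3 by (simp add: coeff_eq_0)
    qed
  qed
  hence "degree ?f \<le> 2 * l + 1" by (intro degree_le) auto
  hence "Q ?f = mu_poly n ?f" by (intro exact) simp
  also have "\<dots> = 0"
  proof -
    have "mu_poly n (p (2 * l + 3)) = 0"
      using gegen_monic_orthogonal[OF n, of "2 * l + 3" 0] by simp
    moreover have "mu_poly n (q * p (Suc l)) = 0"
      using gegen_monic_orthogonal[OF n, of "Suc (Suc l)" "Suc l"] gegen_monic_orthogonal[OF n, of l "Suc l"]
      by (simp add: q_def distrib_right)
    ultimately show ?thesis by simp
  qed
  finally show ?thesis by (simp add: Q_q)
qed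

text \<open>The difference to the square of \<open>p (Suc l)\<close> lies within exact degree, and
  \<open>Q_middle\<close> evaluates that square. The nonzero value is why this degree is left out of
  the space.\<close>

lemma Q_missing: "Q (p (2 * l + 2)) = - c * mu_poly n (p l * p l)"
proof -
  let ?f = "p (2 * l + 2) - p (Suc l) * p (Suc l)"
  have "coeff ?f i = 0" if "i > 2 * l + 1" for i
  proof (cases "i = 2 * l + 2")
    case True
    have "coeff (p (Suc l) * p (Suc l)) (2 * l + 2) = 1"
      using coeff_mult_degree_sum[of "p (Suc l)" "p (Suc l)"] by (simp add: mult_2)
    thus ?thesis using True by simp
  next
    case False
    hence "degree (p (Suc l) * p (Suc l)) < i" using that by (intro degree_mult_less) auto
    thus ?thesis using False that by (simp add: coeff_eq_0)
  qed
  hence "degree ?f \<le> 2 * l + 1" by (intro degree_le) auto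
  hence "Q ?f = mu_poly n ?f" by (intro exact) simp
  hence "Q (p (2 * l + 2)) - Q (p (Suc l) * p (Suc l)) = mu_poly n (p (2 * l + 2)) - mu_poly n (p (Suc l) * p (Suc l))"
    by (simp only: quad_diff mu_poly_diff)
  moreover have "mu_poly n (p (2 * l + 2)) = 0"
    using gegen_monic_orthogonal[OF n, of "2 * l + 2" 0] by simp
  ultimately show ?thesis
    unfolding Q_middle gegen_monic_norm_Suc[OF n, of l] left_diff_distrib by linarith
qed

lemma q_square_coeff:
  "coeff (q * q) (2 * l + 4) = 1" "coeff (q * q) (2 * l + 3) = 0"
  "coeff (q * q) (2 * l + 2) = coeff (p (2 * l + 4)) (2 * l + 2) + (2 * c + quad_shift n (Suc l))"
proof -
  have e: "2 * l + 4 = degree q + degree q" "2 * l + 3 = Suc (Suc l + Suc l)" "2 * l + 2 = Suc (Suc (l + l))"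
    using degree_q(1) by simp_all
  show "coeff (q * q) (2 * l + 4) = 1"
    unfolding e coeff_mult_degree_sum by (simp add: degree_q(1,2))
  show "coeff (q * q) (2 * l + 3) = 0"
    unfolding e by (subst coeff_mult_second) (simp_all add: degree_q(1-3))
  have mid: "coeff (q * q) (2 * l + 2) = 2 * coeff q l"
    unfolding e by (subst coeff_mult_third) (simp_all add: degree_q(1-3))
  have top: "coeff (p (2 * Suc l + 2)) (2 * Suc l) = coeff (p (2 * l + 4)) (2 * l + 2)"
    by (intro arg_cong2[of _ _ _ _ "\<lambda>i j. coeff (p i) j"]) simp_all
  show "coeff (q * q) (2 * l + 2) = coeff (p (2 * l + 4)) (2 * l + 2) + (2 * c + quad_shift n (Suc l))"
    unfolding mid quad_shift_def top degree_q(4) diff_Suc_1 by (simp only: algebra_simps)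
qed

text \<open>Modulo exact degree, \<open>q * q\<close> is \<open>p (2 * l + 4)\<close> plus
  \<open>a\<close> times \<open>p (2 * l + 2)\<close>. Since \<open>Q\<close> annihilates
  \<open>q * q\<close>, the claim becomes an equation between \<open>a * c\<close> and the norm of
  \<open>q\<close>, which is \<open>c_eq\<close>.\<close>

lemma Q_even: "Q (p (2 * l + 4)) = 0"
proof -
  define a where "a = 2 * c + quad_shift n (Suc l)"
  let ?f = "q * q - p (2 * l + 4) - smult a (p (2 * l + 2))"
  have "coeff ?f i = 0" if "i > 2 * l + 1" for i
  proof -
    consider "i = 2 * l + 2" | "i = 2 * l + 3" | "i = 2 * l + 4" | "i > 2 * l + 4" using \<open>i > 2 * l + 1\<close> by linarith
    thus ?thesis
    proof cases
      case 1
      thus ?thesis using q_square_coeff(3) by (simp add: a_def)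
    next
      case 2
      thus ?thesis using q_square_coeff(2) coeff_gegen_monic_second[of n "2 * l + 3"]
        by (simp add: coeff_gegen_monic_ge eval_nat_numeral)
    next
      case 3
      thus ?thesis using q_square_coeff(1) by (simp add: coeff_gegen_monic_ge)
    next
      case 4
      have "degree (q * q) < i" using 4 degree_q by (intro degree_mult_less) auto
      thus ?thesis using 4 by (simp add: coeff_eq_0)
    qed
  qed
  hence "degree ?f \<le> 2 * l + 1" by (intro degree_le) auto
  hence "Q ?f = mu_poly n ?f" by (intro exact) simp
  moreover have "mu_poly n (p (2 * l + 4)) = 0" "mu_poly n (p (2 * l + 2)) = 0"
    using gegen_monic_orthogonal[OF n, of "2 * l + 4" 0] gegen_monic_orthogonal[OF n, of "2 * l + 2" 0] by simp_all
  ultimately have "- Q (p (2 * l + 4)) + a * c * mu_poly n (p l * p l) = mu_poly n (q * q)"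
    using Q_missing by (simp add: Q_q)
  also have "mu_poly n (q * q) = mu_poly n (p (Suc (Suc l)) * p (Suc (Suc l))) + c * c * mu_poly n (p l * p l)"
    using gegen_monic_orthogonal[OF n, of "Suc (Suc l)" l] gegen_monic_orthogonal[OF n, of l "Suc (Suc l)"]
    by (simp add: q_def distrib_left distrib_right)
  also have "\<dots> = (gegen_rec n (Suc (Suc l)) * gegen_rec n (Suc l) + c * c) * mu_poly n (p l * p l)"
    using gegen_monic_norm_Suc[OF n, of l] gegen_monic_norm_Suc[OF n, of "Suc l"]
    by (simp add: algebra_simps)
  also have "\<dots> = a * c * mu_poly n (p l * p l)"
    unfolding c_eq[symmetric] by (simp add: a_def algebra_simps power2_eq_square)
  finally show ?thesis by simp
qed

section \<open>Transfer to the space of normalized polynomials, and minorants within it\<close>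

lemma exact_basis:
  assumes "i \<in> {..<2 * l + 2} \<union> {2 * l + 3, 2 * l + 4}"
  shows "Q (p i) = mu_poly n (p i)"
  using assms exact[of "p i"] Q_odd Q_even gegen_monic_orthogonal[OF n, of i 0] by auto

lemma T_k_eq: "T_k (Suc l) \<union> {0} = {..<2 * l + 2} \<union> {2 * l + 3, 2 * l + 4}"
  by (auto simp: T_k_def)

lemma exact_poly_space:
  assumes "f \<in> poly_space n (T_k (Suc l))"
  shows "mu_integral n f = (\<Sum>i<Suc (Suc l). \<rho> i * f (y i))"
proof -
  obtain a where a: "\<And>t. f t = (\<Sum>i\<in>T_k (Suc l) \<union> {0}. a i * gegenbauer n i t)"
    using assms unfolding poly_space_def by blast
  define F where "F = (\<Sum>i\<in>T_k (Suc l) \<union> {0}. smult (a i * gegen_lead n i) (p i))"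
  have f: "f = poly F"
    by (rule ext) (simp add: a F_def poly_sum gegenbauer_eq_monic[OF n] mult.assoc)
  have "mu_poly n F = Q F"
    unfolding F_def mu_poly_sum quad_sum
  proof (intro sum.cong refl)
    fix i assume "i \<in> T_k (Suc l) \<union> {0}"
    hence "Q (p i) = mu_poly n (p i)" unfolding T_k_eq by (rule exact_basis)
    thus "mu_poly n (smult (a i * gegen_lead n i) (p i)) = Q (smult (a i * gegen_lead n i) (p i))" by simp
  qed
  thus ?thesis by (simp add: f mu_poly_def quad_def)
qed

text \<open>The coefficient condition says that no \<open>p (2 * l + 2)\<close> component is left
  once the top one is removed; \<open>p (2 * l + 3)\<close> has no term of that index.\<close>

lemma poly_space_memI:
  assumes "degree f \<le> 2 * l + 4"
    and "coeff f (2 * l + 2) = coeff f (2 * l + 4) * coeff (p (2 * l + 4)) (2 * l + 2)"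
  shows "poly f \<in> poly_space n (T_k (Suc l))"
proof -
  define g where "g = f - smult (coeff f (2 * l + 4)) (p (2 * l + 4)) - smult (coeff f (2 * l + 3)) (p (2 * l + 3))"
  have "coeff g i = 0" if "i \<ge> 2 * l + 2" for i
  proof -
    consider "i = 2 * l + 2" | "i = 2 * l + 3" | "i = 2 * l + 4" | "i > 2 * l + 4" using \<open>i \<ge> 2 * l + 2\<close> by linarith
    thus ?thesis
    proof cases
      case 1
      thus ?thesis using assms(2) coeff_gegen_monic_second[of n "2 * l + 2"] by (simp add: g_def eval_nat_numeral)
    next
      case 2
      thus ?thesis using coeff_gegen_monic_second[of n "2 * l + 3"] by (simp add: g_def eval_nat_numeral)
    qed (use assms(1) in \<open>auto simp: g_def coeff_eq_0\<close>)
  qed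
  then obtain b where b: "g = (\<Sum>i<2 * l + 2. smult (b i) (p i))"
    using gegen_monic_expansion by blast
  define a where "a = b(2 * l + 3 := coeff f (2 * l + 3), 2 * l + 4 := coeff f (2 * l + 4))"
  have "f = (\<Sum>i\<in>T_k (Suc l) \<union> {0}. smult (a i) (p i))"
  proof -
    have "(\<Sum>i<2 * l + 2. smult (a i) (p i)) = g"
      unfolding b by (intro sum.cong) (auto simp: a_def)
    moreover have "(\<Sum>i\<in>{2 * l + 3, 2 * l + 4}. smult (a i) (p i)) = f - g"
      by (simp add: a_def g_def)
    ultimately show ?thesis
      unfolding T_k_eq by (subst sum.union_disjoint) auto
  qed
  moreover have "gegen_lead n i \<noteq> 0" for i
    using gegen_lead_pos[OF n, of i] by simp
  ultimately have "poly f t = (\<Sum>i\<in>T_k (Suc l) \<union> {0}. (a i / gegen_lead n i) * gegenbauer n i t)" for t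
    by (simp add: poly_sum gegenbauer_eq_monic[OF n])
  thus ?thesis unfolding poly_space_def
    by (intro CollectI exI[of _ "\<lambda>i. a i / gegen_lead n i"]) auto
qed

text \<open>\<open>p (Suc (Suc l))\<close> and \<open>p l\<close> have equal parity, so the zeros of
  \<open>q\<close> are symmetric about 0.\<close>

lemma nonneg_root_exists: "\<exists>m<Suc (Suc l). y m \<ge> 0"
proof (cases "y 0 \<ge> 0")
  case False
  have "poly q (- y 0) = (- 1) ^ l * poly q (y 0)"
    unfolding q_def poly_add poly_smult gegen_monic_minus by (simp add: algebra_simps)
  hence "poly q (- y 0) = 0" using q_root[of 0] by simp
  hence "poly (\<Prod>i<Suc (Suc l). [:- y i, 1:]) (- y 0) = 0" unfolding q_prod .
  then obtain m where "m < Suc (Suc l)" "- y 0 = y m" by (auto simp: poly_prod simp del: prod.lessThan_Suc)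
  thus ?thesis using False by (intro exI[of _ m]) auto
qed auto

lemma minorant_exists:
  assumes y: "\<And>i. i < Suc (Suc l) \<Longrightarrow> y i \<in> {-1<..<1}" and h: "abs_monotone h"
  shows "\<exists>f\<in>lower_set n (T_k (Suc l)) h. \<forall>i<Suc (Suc l). ereal (f (y i)) = h (y i)"
proof -
  obtain D where D: "am_derivs D" and hD: "\<And>t. t \<in> {-1..<1} \<Longrightarrow> h t = ereal (D 0 t)"
    using abs_monotone_derivs[OF h] by blast
  have y': "y i \<in> {-1..<1}" if "i < Suc (Suc l)" for i using y[OF that] by auto
  obtain m where m: "m < Suc (Suc l)" "y m \<ge> 0" using nonneg_root_exists by blast
  obtain H where H: "\<And>i. i \<ge> 2 * l + 4 \<Longrightarrow> coeff H i = 0" "coeff H (2 * l + 2) \<ge> 0"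
      "\<And>i. i < Suc (Suc l) \<Longrightarrow> poly H (y i) = D 0 (y i)" "\<And>x. x \<in> {-1..<1} \<Longrightarrow> poly H x \<le> D 0 x"
    using am_hermite_minorant[where l = l and y = y and q = q and m = m, OF y' D q_prod degree_q(3) m] by blast
  define a where "a = 2 * c + quad_shift n (Suc l)"
  have a: "a > 0" using quad_shift_pos[OF n, of "Suc l"] c_pos by (simp add: a_def)
  \<comment> \<open>Here \<open>a\<close> is the \<open>p (2 * l + 2)\<close> component of
    \<open>q * q\<close>, so this multiple cancels the one of \<open>H\<close>; the nodes are
    unaffected because \<open>q\<close> vanishes there.\<close>
  define f where "f = H - smult (coeff H (2 * l + 2) / a) (q * q)"
  have "poly f \<in> poly_space n (T_k (Suc l))"
  proof (rule poly_space_memI)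
    show "degree f \<le> 2 * l + 4"
    proof (rule degree_le, intro allI impI)
      fix i assume i: "2 * l + 4 < i"
      have "degree (q * q) < i" using i degree_q by (intro degree_mult_less) auto
      thus "coeff f i = 0" using i H(1) by (simp add: f_def coeff_eq_0)
    qed
    show "coeff f (2 * l + 2) = coeff f (2 * l + 4) * coeff (p (2 * l + 4)) (2 * l + 2)"
      using a H(1) q_square_coeff(1,3) unfolding a_def[symmetric] by (simp add: f_def field_simps)
  qed
  moreover have "ereal (poly f t) \<le> h t" if "t \<in> {-1..1}" for t
  proof (rule abs_monotone_minorantI[OF h _ that])
    fix t :: real assume t: "t \<in> {-1..<1}"
    have "poly f t \<le> poly H t" using a H(2) by (simp add: f_def)
    thus "ereal (poly f t) \<le> h t" using H(4)[OF t] hD[OF t] by simp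
  qed
  moreover have "ereal (poly f (y i)) = h (y i)" if "i < Suc (Suc l)" for i
    using H(3)[OF that] q_root[OF that] hD[OF y'[OF that]] by (simp add: f_def)
  ultimately show ?thesis unfolding lower_set_def by blast
qed

end

theorem theorem4p14:
  fixes n k :: nat
  assumes "n \<ge> 3" and "k \<ge> 1"
  shows "PULB_space n (T_k k)"
proof -
  obtain l where k: "k = Suc l" using assms(2) by (cases k) auto
  obtain c where c: "0 < c" "c < gegen_rec n (Suc l)"
      "c\<^sup>2 + quad_shift n (Suc l) * c = gegen_rec n (Suc (Suc l)) * gegen_rec n (Suc l)"
    using quad_param_exists[OF assms] unfolding k by blast
  define q where "q = gegen_monic n (Suc (Suc l)) + smult c (gegen_monic n l)"
  have "interlaced (Suc l) (gegen_monic n (Suc l)) q"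
  \<comment> \<open>The recurrence step with \<open>gegen_rec n (Suc l)\<close> lowered by
    \<open>c\<close> places the nodes inside (-1, 1).\<close>
  proof (rule interlaced_step[OF interlaced_gegen_monic[OF assms(1)]])
    show "gegen_rec n (Suc l) - c > 0" using c by simp
    show "q = [:0, 1:] * gegen_monic n (Suc l) - smult (gegen_rec n (Suc l) - c) (gegen_monic n l)"
      by (simp add: q_def gegen_monic.simps(3) smult_diff_left)
    show "poly q 1 > 0"
      unfolding q_def poly_add poly_smult using c gegen_monic_at_1[OF assms(1)] by (intro add_pos_pos mult_pos_pos)
    have "poly q (- 1) = (- 1) ^ l * poly q 1"
      unfolding q_def poly_add poly_smult gegen_monic_minus by (simp add: algebra_simps)
    thus "poly q (- 1) * (- 1) ^ l > 0"
      using \<open>poly q 1 > 0\<close> by (simp add: neg_one_power_conj)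
  qed
  then obtain y where y: "inj_on y {..<Suc (Suc l)}" "\<And>i. i < Suc (Suc l) \<Longrightarrow> y i \<in> {-1<..<1}"
      "q = (\<Prod>i<Suc (Suc l). [:- y i, 1:])"
    by (rule interlaced_roots) blast
  obtain \<rho> where \<rho>: "\<And>f. degree f < Suc (Suc l) \<Longrightarrow> mu_poly n f = quad (Suc (Suc l)) y \<rho> f"
    using interpolatory_weights_exist[OF y(1)] by blast
  interpret gegen_quadrature n l c y \<rho>
    by unfold_locales (use assms c y \<rho> in \<open>auto simp: q_def\<close>)
  show ?thesis unfolding PULB_space_def k
  proof (intro exI conjI allI ballI impI)
    show "y i \<in> {-1..1}" if "i < Suc (Suc l)" for i using y(2)[OF that] by auto
    show "0 < \<rho> i" "\<rho> i < 1" if "i < Suc (Suc l)" for i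
      using weight_gt_0[OF that] weight_less_1[OF that] by auto
    show "mu_integral n f = (\<Sum>i<Suc (Suc l). \<rho> i * f (y i))" if "f \<in> poly_space n (T_k (Suc l))" for f
      using that by (rule exact_poly_space)
    show "\<exists>f\<in>lower_set n (T_k (Suc l)) h. \<forall>i<Suc (Suc l). ereal (f (y i)) = h (y i)" if "abs_monotone h" for h
      using y(2) that by (rule minorant_exists)
  qed
qed

end
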